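(* Let $V$ be a linear isometry on a complex Hilbert space $H$. Then $V$ can be embedded into a $C_0$-semigroup on $H$ if and only if $V$ is unitary or $\operatorname{codim}(\operatorname{rg} V)=\infty$.
   Context: A linear operator $T$ on a Banach space $X$ can be embedded into a $C_0$-semigroup (is embeddable) if there exists a $C_0$-semigroup (strongly continuous one-parameter semigroup of bounded linear operators) $(T(t))_{t\ge 0}$ on $X$ such that $T=T(1)$. Here $\operatorname{rg} V$ is the range of $V$, $\operatorname{codim}(\operatorname{rg} V)=\dim(H/\operatorname{rg} V)$, and $=\infty$ means that this dimension is not finite. *)

theory Defs
  imports "HOL-Analysis.Analysis"
begin

section \<open>Complex vector spaces, Banach spaces and Hilbert spaces\<close>

text \<open>
  The real classes of the library are extended by a complex scalar multiplication whose restriction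
  to real scalars is the given real one, so that norms, limits, completeness and continuity are
  those of the library.
\<close>

class complex_vector = real_vector +
  fixes scaleC :: "complex \<Rightarrow> 'a \<Rightarrow> 'a"  (infixr \<open>*\<^sub>C\<close> 75)
  assumes scaleC_add_right: "a *\<^sub>C (x + y) = a *\<^sub>C x + a *\<^sub>C y"
    and scaleC_add_left: "(a + b) *\<^sub>C x = a *\<^sub>C x + b *\<^sub>C x"
    and scaleC_scaleC: "a *\<^sub>C b *\<^sub>C x = (a * b) *\<^sub>C x"
    and scaleC_one: "1 *\<^sub>C x = x"
    and scaleR_scaleC: "r *\<^sub>R x = complex_of_real r *\<^sub>C x"

global_interpretation complex_vector:
  vector_space "scaleC :: complex \<Rightarrow> 'a \<Rightarrow> 'a::complex_vector"
  by unfold_locales (simp_all add: scaleC_add_right scaleC_add_left scaleC_scaleC scaleC_one)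

class complex_normed_vector = complex_vector + real_normed_vector +
  assumes norm_scaleC: "norm (a *\<^sub>C x) = cmod a * norm x"

class cbanach = complex_normed_vector + complete_space

text \<open>
  The inner product is linear in its first argument. Positive definiteness and
  the relation to the norm come from \<^class>\<open>real_inner\<close> because the real part
  of \<open>cinner\<close> is the real inner product; see \<open>cinner_self\<close> below.
\<close>

class complex_inner = complex_vector + real_inner +
  fixes cinner :: "'a \<Rightarrow> 'a \<Rightarrow> complex"
  assumes cinner_commute: "cinner x y = cnj (cinner y x)"
    and cinner_add_left: "cinner (x + y) z = cinner x z + cinner y z"
    and cinner_scaleC_left: "cinner (a *\<^sub>C x) y = a * cinner x y"
    and inner_eq_Re_cinner: "inner x y = Re (cinner x y)"

lemma cinner_self: "cinner x x = complex_of_real ((norm x)\<^sup>2)"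
  for x :: "'a::complex_inner"
proof (rule complex_eqI)
  show "Re (cinner x x) = Re (complex_of_real ((norm x)\<^sup>2))"
    by (simp add: power2_norm_eq_inner inner_eq_Re_cinner)
  have "Im (cinner x x) = Im (cnj (cinner x x))"
    using cinner_commute[of x x] by simp
  then show "Im (cinner x x) = Im (complex_of_real ((norm x)\<^sup>2))"
    by simp
qed

lemma cinner_scaleC_right: "cinner x (a *\<^sub>C y) = cnj a * cinner x y"
  for x y :: "'a::complex_inner"
  by (metis cinner_commute cinner_scaleC_left complex_cnj_mult)

instance complex_inner \<subseteq> complex_normed_vector
proof
  fix a :: complex and x :: 'a
  have "complex_of_real ((norm (a *\<^sub>C x))\<^sup>2) = a * cnj a * cinner x x"
    by (simp only: cinner_self [symmetric] cinner_scaleC_left cinner_scaleC_right mult_ac)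
  also have "\<dots> = complex_of_real ((cmod a * norm x)\<^sup>2)"
    by (simp only: cinner_self complex_norm_square [symmetric] power_mult_distrib of_real_mult)
  finally have "(norm (a *\<^sub>C x))\<^sup>2 = (cmod a * norm x)\<^sup>2"
    by (simp only: of_real_eq_iff)
  then show "norm (a *\<^sub>C x) = cmod a * norm x"
    by (simp add: power2_eq_iff_nonneg)
qed

class chilbert_space = complex_inner + complete_space

instance chilbert_space \<subseteq> cbanach ..

instantiation complex :: chilbert_space
begin

definition scaleC_complex :: "complex \<Rightarrow> complex \<Rightarrow> complex"
  where "scaleC_complex a x = a * x"

definition cinner_complex :: "complex \<Rightarrow> complex \<Rightarrow> complex"
  where "cinner_complex x y = x * cnj y"

instance
  by standard
    (simp_all add: scaleC_complex_def cinner_complex_def algebra_simps scaleR_conv_of_real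
      inner_complex_def)

end


section \<open>Operators\<close>

abbreviation clinear :: "('a::complex_vector \<Rightarrow> 'b::complex_vector) \<Rightarrow> bool"
  where "clinear \<equiv> Vector_Spaces.linear scaleC scaleC"

definition bounded_clinear ::
    "('a::complex_normed_vector \<Rightarrow> 'b::complex_normed_vector) \<Rightarrow> bool"
  where "bounded_clinear T \<longleftrightarrow> clinear T \<and> (\<exists>K. \<forall>x. norm (T x) \<le> K * norm x)"

definition linear_isometry ::
    "('a::complex_normed_vector \<Rightarrow> 'b::complex_normed_vector) \<Rightarrow> bool"
  where "linear_isometry V \<longleftrightarrow> clinear V \<and> (\<forall>x. norm (V x) = norm x)"

definition is_cadjoint ::
    "('a::complex_inner \<Rightarrow> 'b::complex_inner) \<Rightarrow> ('b \<Rightarrow> 'a) \<Rightarrow> bool"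
  where "is_cadjoint U W \<longleftrightarrow> (\<forall>x y. cinner (U x) y = cinner x (W y))"

lemma is_cadjoint_unique:
  assumes "is_cadjoint U W" "is_cadjoint U W'"
  shows "W = W'"
proof
  fix y
  have "inner x (W y) = inner x (W' y)" for x
    using assms unfolding is_cadjoint_def inner_eq_Re_cinner by metis
  then show "W y = W' y"
    using vector_eq_ldot by blast
qed

definition unitary :: "('a::chilbert_space \<Rightarrow> 'a) \<Rightarrow> bool"
  where "unitary U \<longleftrightarrow>
    bounded_clinear U \<and> (\<exists>W. is_cadjoint U W \<and> W \<circ> U = id \<and> U \<circ> W = id)"


section \<open>Strongly continuous semigroups\<close>

text \<open>
  A one-parameter semigroup is a function on \<^typ>\<open>real\<close> of which only the values
  at \<open>t \<ge> 0\<close> matter.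
\<close>

definition C0_semigroup :: "(real \<Rightarrow> 'a::cbanach \<Rightarrow> 'a) \<Rightarrow> bool"
  where "C0_semigroup T \<longleftrightarrow>
    (\<forall>t\<ge>0. bounded_clinear (T t)) \<and>
    T 0 = id \<and>
    (\<forall>s\<ge>0. \<forall>t\<ge>0. T (s + t) = T s \<circ> T t) \<and>
    (\<forall>x. continuous_on {0..} (\<lambda>t. T t x))"

definition embeddable :: "('a::cbanach \<Rightarrow> 'a) \<Rightarrow> bool"
  where "embeddable A \<longleftrightarrow> (\<exists>T. C0_semigroup T \<and> A = T 1)"


section \<open>Codimension\<close>

text \<open>
  For a subspace \<open>M\<close>, the elements of the quotient space are the cosets
  \<open>coset M x\<close>, and the vector space operations act on representatives. A finite set
  \<open>B\<close> of vectors represents a basis of the quotient if the cosets of its elements are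
  linearly independent (in particular pairwise distinct) and span the quotient. Every finite
  basis of the quotient is represented in this way.
\<close>

definition coset :: "'a::complex_vector set \<Rightarrow> 'a \<Rightarrow> 'a set"
  where "coset M x = {x + m | m. m \<in> M}"

definition finite_quotient_basis :: "'a::complex_vector set \<Rightarrow> 'a set \<Rightarrow> bool"
  where "finite_quotient_basis M B \<longleftrightarrow> finite B \<and>
    (\<forall>c. coset M (\<Sum>b\<in>B. c b *\<^sub>C b) = coset M 0 \<longrightarrow> (\<forall>b\<in>B. c b = 0)) \<and>
    (\<forall>x. \<exists>c. coset M x = coset M (\<Sum>b\<in>B. c b *\<^sub>C b))"

text \<open>
  All finite bases of the quotient have the same cardinality; the infimum selects it, and is
  \<open>\<infinity>\<close> if there is no finite basis.
\<close>

definition codim :: "'a::complex_vector set \<Rightarrow> enat"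
  where "codim M = (INF B\<in>{B. finite_quotient_basis M B}. enat (card B))"

lemma codim_eq_infinity_iff: "codim M = \<infinity> \<longleftrightarrow> (\<nexists>B. finite_quotient_basis M B)"
proof
  assume *: "codim M = \<infinity>"
  show "\<nexists>B. finite_quotient_basis M B"
  proof
    assume "\<exists>B. finite_quotient_basis M B"
    then obtain B where "finite_quotient_basis M B" ..
    then have "codim M \<le> enat (card B)"
      unfolding codim_def by (intro INF_lower) simp
    with * show False by simp
  qed
next
  assume "\<nexists>B. finite_quotient_basis M B"
  then show "codim M = \<infinity>"
    by (simp add: codim_def top_enat_def)
qed

end

theory Submission
  imports Defs
begin

text \<open>
  If \<open>V = S\<^sup>n\<close> with \<open>S = T (1/n)\<close> injective and \<open>e\<close> not in the range of \<open>S\<close>, then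
  \<open>e, S e, \<dots>, S\<^sup>n\<^sup>-\<^sup>1 e\<close> are independent modulo the range of \<open>V\<close>. Hence an embeddable isometry is
  surjective or has a range of infinite codimension.

  Conversely, it suffices to find isometries \<open>V = V\<^sub>0, V\<^sub>1, \<dots>\<close> with \<open>V\<^sub>n\<^sub>+\<^sub>1\<^sup>2 = V\<^sub>n\<close> such that
  \<open>\<parallel>V\<^sub>n x - x\<parallel>\<close> is summable for a total set of vectors \<open>x\<close>; the semigroup at \<open>t\<close> is then the strong
  limit of the powers of \<open>V\<^sub>n\<close> with exponent \<open>\<lfloor>2\<^sup>n t\<rfloor>\<close>. A unitary operator \<open>U\<close> has a unitary square
  root \<open>W\<close> with nonnegative real part, so \<open>\<parallel>W x - x\<parallel>\<^sup>2 \<le> \<parallel>U x - x\<parallel>\<^sup>2 / 2\<close>, and this can be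
  iterated. If the wandering subspace of \<open>V\<close> is infinite-dimensional, the Wold decomposition
  splits \<open>V\<close> into a unitary operator and the translation by \<open>1\<close> on a sum of copies of
  \<open>L\<^sup>2\<close> of the half line. The latter has translations by \<open>1/2\<^sup>n\<close> as roots, which are
  described combinatorially through the Haar basis.
\<close>

section \<open>Isometries of Hilbert spaces\<close>

lemma nearest_point_exists:
  fixes S :: "'a::{real_inner,complete_space} set"
  assumes S: "subspace S" and "closed S"
  obtains y where "y \<in> S" "\<And>s. s \<in> S \<Longrightarrow> norm (x - y) \<le> norm (x - s)"
proof -
  define D where "D = (INF s\<in>S. (norm (x - s))\<^sup>2)"
  have bdd: "bdd_below ((\<lambda>s. (norm (x - s))\<^sup>2) ` S)"
    by (rule bdd_belowI[of _ 0]) auto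
  have ne: "S \<noteq> {}"
    using subspace_0[OF S] by auto
  have low: "D \<le> (norm (x - s))\<^sup>2" if "s \<in> S" for s
    unfolding D_def using bdd that by (rule cINF_lower)
  have "\<exists>s\<in>S. (norm (x - s))\<^sup>2 < D + 1 / real (Suc n)" for n
    using cINF_less_iff[OF ne bdd, of "D + 1 / real (Suc n)"] unfolding D_def by simp
  then obtain y where yS: "\<And>n. y n \<in> S"
    and y: "\<And>n. (norm (x - y n))\<^sup>2 < D + 1 / real (Suc n)"
    by metis
  \<comment> \<open>The midpoint of \<open>y n\<close> and \<open>y m\<close> lies in
    \<open>S\<close>, so its squared distance from \<open>x\<close> is at least \<open>D\<close>;
    the parallelogram law then leaves only the two excesses over \<open>D\<close>.\<close>
  have par: "(norm (y n - y m))\<^sup>2 \<le> 2 / real (Suc n) + 2 / real (Suc m)" for n m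
  proof -
    have "(1/2) *\<^sub>R (y n + y m) \<in> S"
      using S yS by (simp add: subspace_add subspace_scale)
    from low[OF this] have "4 * D \<le> 4 * (norm (x - (1/2) *\<^sub>R (y n + y m)))\<^sup>2"
      by simp
    moreover have "(norm (y n - y m))\<^sup>2 + 4 * (norm (x - (1/2) *\<^sub>R (y n + y m)))\<^sup>2
        = 2 * (norm (x - y n))\<^sup>2 + 2 * (norm (x - y m))\<^sup>2"
      by (simp add: power2_norm_eq_inner algebra_simps inner_commute)
    ultimately show ?thesis
      using y[of n] y[of m] by simp
  qed
  have "Cauchy y"
  proof (rule metric_CauchyI)
    fix e :: real assume "e > 0"
    then obtain M where M: "4 / real (Suc M) < e\<^sup>2"
      using reals_Archimedean[of "e\<^sup>2 / 4"] by (auto simp: field_simps)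
    have "dist (y m) (y n) < e" if "m \<ge> M" "n \<ge> M" for m n
    proof -
      have "2 / real (Suc k) \<le> 2 / real (Suc M)" if "k \<ge> M" for k
        using that by (simp add: frac_le)
      then have "(norm (y m - y n))\<^sup>2 < e\<^sup>2"
        using par[of m n] M that by (smt (verit, best) add_divide_distrib)
      then show ?thesis
        using \<open>e > 0\<close> by (simp add: dist_norm power_less_imp_less_base)
    qed
    then show "\<exists>M. \<forall>m\<ge>M. \<forall>n\<ge>M. dist (y m) (y n) < e"
      by blast
  qed
  then obtain l where l: "y \<longlonglongrightarrow> l"
    using Cauchy_convergent convergent_def by blast
  have "l \<in> S"
    using closed_sequentially[OF \<open>closed S\<close> _ l] yS by blast
  moreover have "norm (x - l) \<le> norm (x - s)" if "s \<in> S" for s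
  proof -
    have "(\<lambda>n. (norm (x - y n))\<^sup>2) \<longlonglongrightarrow> (norm (x - l))\<^sup>2"
      by (intro tendsto_intros l)
    moreover have "(\<lambda>n. D + 1 / real (Suc n)) \<longlonglongrightarrow> D + 0"
      by (intro tendsto_intros LIMSEQ_inverse_real_of_nat[unfolded inverse_eq_divide])
    ultimately have "(norm (x - l))\<^sup>2 \<le> D + 0"
      by (rule LIMSEQ_le) (use y less_imp_le in blast)
    with low[OF that] have "(norm (x - l))\<^sup>2 \<le> (norm (x - s))\<^sup>2"
      by linarith
    then show ?thesis
      by (rule power2_le_imp_le) simp
  qed
  ultimately show thesis
    by (rule that)
qed

text \<open>The nearest point works: if the residual had a component along \<open>s\<close>, moving
  by that component would come closer to \<open>x\<close>.\<close>

lemma orthogonal_projection_exists: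
  fixes S :: "'a::{real_inner,complete_space} set"
  assumes S: "subspace S" and "closed S"
  obtains y where "y \<in> S" "\<And>s. s \<in> S \<Longrightarrow> inner (x - y) s = 0"
proof -
  obtain y where y: "y \<in> S" "\<And>s. s \<in> S \<Longrightarrow> norm (x - y) \<le> norm (x - s)"
    using nearest_point_exists[OF assms] by blast
  have "inner (x - y) s = 0" if s: "s \<in> S" for s
  proof (cases "s = 0")
    case False
    define t where "t = inner (x - y) s / inner s s"
    have pos: "inner s s > 0"
      using False by simp
    have "y + t *\<^sub>R s \<in> S"
      using S s y(1) by (simp add: subspace_add subspace_scale)
    from y(2)[OF this] have "(norm (x - y))\<^sup>2 \<le> (norm ((x - y) - t *\<^sub>R s))\<^sup>2"
      by (simp add: algebra_simps)
    also have "\<dots> = (norm (x - y))\<^sup>2 - 2 * t * inner (x - y) s + t * t * inner s s"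
      unfolding power2_norm_eq_inner
      by (simp add: inner_diff_left inner_diff_right inner_commute algebra_simps)
    also have "t * t * inner s s = t * inner (x - y) s"
      using pos by (simp add: t_def)
    finally have "t * inner (x - y) s \<le> 0"
      by simp
    then have "(inner (x - y) s)\<^sup>2 \<le> 0"
      using pos by (simp add: t_def power2_eq_square divide_le_0_iff)
    then show ?thesis
      by simp
  qed simp
  with y(1) show thesis
    by (rule that)
qed

lemma closure_of_subspace:
  fixes S :: "'a::real_normed_vector set"
  assumes "subspace S"
  shows "subspace (closure S)"
proof (rule subspaceI)
  show "0 \<in> closure S"
    using subspace_0[OF assms] closure_subset by blast
next
  fix x y assume "x \<in> closure S" "y \<in> closure S"
  then obtain u v where "\<And>n. u n \<in> S" "u \<longlonglongrightarrow> x" "\<And>n. v n \<in> S" "v \<longlonglongrightarrow> y"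
    unfolding closure_sequential by blast
  then show "x + y \<in> closure S"
    unfolding closure_sequential using subspace_add[OF assms]
    by (intro exI[of _ "\<lambda>n. u n + v n"]) (auto intro: tendsto_add)
next
  fix c :: real and x assume "x \<in> closure S"
  then obtain u where "\<And>n. u n \<in> S" "u \<longlonglongrightarrow> x"
    unfolding closure_sequential by blast
  then show "c *\<^sub>R x \<in> closure S"
    unfolding closure_sequential using subspace_scale[OF assms]
    by (intro exI[of _ "\<lambda>n. c *\<^sub>R u n"]) (auto intro: tendsto_scaleR)
qed

text \<open>Projecting a vector onto the closure of \<open>S\<close> leaves a residual orthogonal to
  \<open>S\<close>, which is therefore zero.\<close>

lemma dense_subspaceI:
  fixes S :: "'a::{real_inner,complete_space} set"
  assumes S: "subspace S" and triv: "\<And>y. (\<And>s. s \<in> S \<Longrightarrow> inner s y = 0) \<Longrightarrow> y = 0"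
  shows "closure S = UNIV"
proof -
  have "x \<in> closure S" for x
  proof -
    obtain y where y: "y \<in> closure S" "\<And>s. s \<in> closure S \<Longrightarrow> inner (x - y) s = 0"
      using orthogonal_projection_exists[OF closure_of_subspace[OF S], of x] by auto
    have "x - y = 0"
      using y(2) closure_subset by (intro triv) (auto simp: inner_commute)
    with y(1) show ?thesis
      by simp
  qed
  then show ?thesis
    by blast
qed

section \<open>Complex-linear isometries and their extension from dense domains\<close>

lemma clinearI:
  assumes "\<And>x y. f (x + y) = f x + f y" "\<And>c x. f (c *\<^sub>C x) = c *\<^sub>C f x"
  shows "clinear f"
  using assms by unfold_locales auto

lemma clinear_imp_linear:
  assumes "clinear f"
  shows "linear f"
proof -
  interpret Vector_Spaces.linear scaleC scaleC f
    by fact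
  show ?thesis
    by (rule linearI) (simp_all add: add scale scaleR_scaleC)
qed

lemma clinear_scaleC: "clinear f \<Longrightarrow> f (c *\<^sub>C x) = c *\<^sub>C f x"
  by (simp add: Vector_Spaces.linear_iff)

lemma linear_isometryI:
  assumes "\<And>x y. f (x + y) = f x + f y" "\<And>c x. f (c *\<^sub>C x) = c *\<^sub>C f x"
    "\<And>x. norm (f x) = norm x"
  shows "linear_isometry f"
  using assms by (simp add: linear_isometry_def clinearI)

lemma linear_isometryD:
  assumes "linear_isometry f"
  shows linear_isometry_clinear: "clinear f"
    and linear_isometry_linear: "linear f"
    and linear_isometry_add: "f (x + y) = f x + f y"
    and linear_isometry_diff: "f (x - y) = f x - f y"
    and linear_isometry_scaleC: "f (c *\<^sub>C x) = c *\<^sub>C f x"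
    and linear_isometry_norm: "norm (f x) = norm x"
proof -
  show f: "clinear f" and "norm (f x) = norm x"
    using assms by (auto simp: linear_isometry_def)
  then show "linear f" "f (x + y) = f x + f y" "f (x - y) = f x - f y" "f (c *\<^sub>C x) = c *\<^sub>C f x"
    using clinear_imp_linear[OF f] by (auto simp: linear_add linear_diff clinear_scaleC)
qed

lemma linear_isometry_compose:
  assumes "linear_isometry f" "linear_isometry g"
  shows "linear_isometry (f \<circ> g)"
  using assms by (intro linear_isometryI) (simp_all add: linear_isometryD)

lemma linear_isometry_funpow:
  fixes f :: "'a::complex_normed_vector \<Rightarrow> 'a"
  shows "linear_isometry f \<Longrightarrow> linear_isometry (f ^^ n)"
proof (induction n)
  case 0
  show ?case
    by (intro linear_isometryI) simp_all
next
  case (Suc n)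
  then show ?case
    using linear_isometry_compose[of f "f ^^ n"] by (simp add: comp_def)
qed

lemma linear_isometry_inner:
  fixes f :: "'a::complex_inner \<Rightarrow> 'b::complex_inner"
  assumes "linear_isometry f"
  shows "inner (f x) (f y) = inner x y"
  using linear_isometry_norm[OF assms, of "x + y"]
  by (simp add: linear_isometryD[OF assms] dot_norm)

text \<open>Conjugate linearity in the second argument turns the imaginary part into a real part, so
  facts about \<open>inner\<close> that are stable under multiplication by \<open>\<i>\<close> carry
  over to \<open>cinner\<close>.\<close>

lemma cinner_eq_inner:
  "cinner x y = Complex (inner x y) (inner x (\<i> *\<^sub>C y))"
  by (simp add: complex_eq_iff inner_eq_Re_cinner cinner_scaleC_right)

lemma linear_isometry_cinner:
  fixes f :: "'a::complex_inner \<Rightarrow> 'b::complex_inner"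
  assumes "linear_isometry f"
  shows "cinner (f x) (f y) = cinner x y"
  by (simp add: cinner_eq_inner linear_isometry_scaleC[OF assms, symmetric]
      linear_isometry_inner[OF assms])

lemma linear_isometry_inj: "linear_isometry f \<Longrightarrow> inj f"
  by (metis (no_types, lifting) eq_iff_diff_eq_0 injI linear_isometry_diff linear_isometry_norm
      norm_eq_zero)

lemma linear_isometry_continuous: "linear_isometry f \<Longrightarrow> continuous_on A f"
  by (intro linear_continuous_on linear_linear[THEN iffD2] bounded_linear_intro[where K = 1])
    (auto simp: linear_isometryD linear_scale linear_isometry_linear)

lemma linear_isometry_tendsto:
  assumes "linear_isometry f" "(g \<longlongrightarrow> l) F"
  shows "((\<lambda>x. f (g x)) \<longlongrightarrow> f l) F"
  using linear_isometry_continuous[OF assms(1), of UNIV] assms(2)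
  by (auto simp: continuous_on_eq_continuous_at isCont_tendsto_compose)

lemma tendsto_scaleC:
  assumes "(g \<longlongrightarrow> l) F"
  shows "((\<lambda>x. c *\<^sub>C g x) \<longlongrightarrow> c *\<^sub>C (l::'a::complex_normed_vector)) F"
proof (rule Lim_null[THEN iffD2])
  have "((\<lambda>x. cmod c * norm (g x - l)) \<longlongrightarrow> cmod c * 0) F"
    by (intro tendsto_intros tendsto_norm_zero) (use assms Lim_null in blast)
  then show "((\<lambda>x. c *\<^sub>C g x - c *\<^sub>C l) \<longlongrightarrow> 0) F"
    unfolding complex_vector.scale_right_diff_distrib[symmetric]
    by (intro tendsto_norm_zero_cancel[where f = "\<lambda>x. c *\<^sub>C (g x - l)"]) (simp add: norm_scaleC)
qed

lemma linear_isometry_ext: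
  assumes f: "linear_isometry f" and g: "linear_isometry g"
    and eq: "\<And>x. x \<in> S \<Longrightarrow> f x = g x" and dense: "closure S = UNIV"
  shows "f = g"
proof
  fix x
  have "norm (f x - g x) \<le> 0"
  proof (rule continuous_le_on_closure[where S = S])
    show "continuous_on (closure S) (\<lambda>x. norm (f x - g x))"
      by (intro continuous_on_norm continuous_on_diff linear_isometry_continuous f g)
  qed (use dense eq in auto)
  then show "f x = g x"
    by simp
qed

text \<open>The densely defined map is given as a graph \<open>G\<close>. Well-definedness is then
  automatic: the norm condition on differences of pairs makes the relation single-valued.\<close>

lemma isometry_extension:
  fixes G :: "('a::chilbert_space \<times> 'a) set"
  assumes add: "\<And>x y x' y'. (x, y) \<in> G \<Longrightarrow> (x', y') \<in> G \<Longrightarrow> (x + x', y + y') \<in> G"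
    and scale: "\<And>c x y. (x, y) \<in> G \<Longrightarrow> (c *\<^sub>C x, c *\<^sub>C y) \<in> G"
    and norm: "\<And>x y. (x, y) \<in> G \<Longrightarrow> norm y = norm x"
    and dense: "closure (fst ` G) = UNIV"
  obtains L where "linear_isometry L" "\<And>x y. (x, y) \<in> G \<Longrightarrow> L x = y"
proof -
  have diff: "(x - x', y - y') \<in> G" if "(x, y) \<in> G" "(x', y') \<in> G" for x y x' y'
    using add[OF that(1) scale[OF that(2), of "-1"]] by simp
  \<comment> \<open>\<open>R\<close> is the sequential closure of \<open>G\<close>. Density and
    completeness make it total, and \<open>R_norm\<close> on differences makes it
    single-valued.\<close>
  define R where "R x l \<longleftrightarrow> (\<exists>u v. (\<forall>n. (u n, v n) \<in> G) \<and> u \<longlonglongrightarrow> x \<and> v \<longlonglongrightarrow> l)" for x l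
  have R_add: "R (x + x') (l + l')" if R: "R x l" "R x' l'" for x l x' l'
  proof -
    obtain u v where "\<forall>n. (u n, v n) \<in> G" "u \<longlonglongrightarrow> x" "v \<longlonglongrightarrow> l"
      using R(1) unfolding R_def by blast
    moreover obtain u' v' where "\<forall>n. (u' n, v' n) \<in> G" "u' \<longlonglongrightarrow> x'" "v' \<longlonglongrightarrow> l'"
      using R(2) unfolding R_def by blast
    ultimately show ?thesis
      unfolding R_def
      by (intro exI[of _ "\<lambda>n. u n + u' n"] exI[of _ "\<lambda>n. v n + v' n"])
        (auto intro: add tendsto_add)
  qed
  have R_scale: "R (c *\<^sub>C x) (c *\<^sub>C l)" if R: "R x l" for c x l
  proof -
    obtain u v where "\<forall>n. (u n, v n) \<in> G" "u \<longlonglongrightarrow> x" "v \<longlonglongrightarrow> l"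
      using R unfolding R_def by blast
    then show ?thesis
      unfolding R_def
      by (intro exI[of _ "\<lambda>n. c *\<^sub>C u n"] exI[of _ "\<lambda>n. c *\<^sub>C v n"])
        (auto intro: scale tendsto_scaleC)
  qed
  have R_norm: "norm l = norm x" if R: "R x l" for x l
  proof -
    obtain u v where uv: "\<forall>n. (u n, v n) \<in> G" "u \<longlonglongrightarrow> x" "v \<longlonglongrightarrow> l"
      using R unfolding R_def by blast
    have "norm (v n) = norm (u n)" for n
      using norm uv(1) by blast
    with tendsto_norm[OF uv(3)] have "(\<lambda>n. norm (u n)) \<longlonglongrightarrow> norm l"
      by simp
    then show ?thesis
      using LIMSEQ_unique tendsto_norm[OF uv(2)] by blast
  qed
  have R_ex: "\<exists>l. R x l" for x
  proof -
    have "x \<in> closure (fst ` G)"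
      using dense by simp
    then obtain u where u: "\<And>n. u n \<in> fst ` G" "u \<longlonglongrightarrow> x"
      unfolding closure_sequential by blast
    have "\<forall>n. \<exists>y. (u n, y) \<in> G"
      using u(1) by force
    then obtain v where v: "\<And>n. (u n, v n) \<in> G"
      using choice[of "\<lambda>n y. (u n, y) \<in> G"] by blast
    have "dist (v m) (v n) = dist (u m) (u n)" for m n
      using norm[OF diff[OF v v]] by (simp add: dist_norm)
    then have "Cauchy v"
      using LIMSEQ_imp_Cauchy[OF u(2)] by (simp add: Cauchy_def)
    then obtain l where "v \<longlonglongrightarrow> l"
      using Cauchy_convergent convergent_def by blast
    with u v show ?thesis
      unfolding R_def by blast
  qed
  have R_unique: "l = l'" if "R x l" "R x l'" for x l l'
    using R_norm[OF R_add[OF that(1) R_scale[OF that(2), of "-1"]]] by simp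
  define L where "L x = (THE l. R x l)" for x
  have L: "R x (L x)" for x
    unfolding L_def using R_ex R_unique by (metis theI)
  have "linear_isometry L"
    using R_unique L R_add R_scale R_norm by (intro linear_isometryI) blast+
  moreover have "L x = y" if "(x, y) \<in> G" for x y
  proof (rule R_unique[OF L])
    show "R x y"
      unfolding R_def using that by (intro exI[of _ "\<lambda>n. x"] exI[of _ "\<lambda>n. y"]) simp
  qed
  ultimately show thesis
    by (rule that)
qed

text \<open>In a Hilbert space: the closed complex span is everything.\<close>

definition total_set :: "'a::complex_inner set \<Rightarrow> bool"
  where "total_set S \<longleftrightarrow> (\<forall>y. (\<forall>x\<in>S. cinner x y = 0) \<longrightarrow> y = 0)"

lemma cinner_eq_0I:
  assumes "inner x y = 0" "inner (\<i> *\<^sub>C x) y = 0"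
  shows "cinner x y = 0"
  using assms by (simp add: inner_eq_Re_cinner cinner_scaleC_left complex_eq_iff)

text \<open>Equal Gram matrices make \<open>f a \<mapsto> g a\<close> preserve inner products of all
  linear combinations, hence norms; totality makes the domain dense.\<close>

lemma isometry_from_gram:
  fixes f g :: "'i \<Rightarrow> 'a::chilbert_space"
  assumes gram: "\<And>a b. a \<in> A \<Longrightarrow> b \<in> A \<Longrightarrow> cinner (g a) (g b) = cinner (f a) (f b)"
    and tot: "total_set (f ` A)"
  obtains L where "linear_isometry L" "\<And>a. a \<in> A \<Longrightarrow> L (f a) = g a"
proof -
  \<comment> \<open>\<open>span\<close> is the real span, so \<open>B\<close> contains all complex
    multiples; its span is then stable under complex scalars (\<open>scale\<close> below).\<close>
  define B where "B = {(c *\<^sub>C f a, c *\<^sub>C g a) | c a. a \<in> A}"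
  have inB: "(c *\<^sub>C f a, c *\<^sub>C g a) \<in> span B" if "a \<in> A" for c a
    using that unfolding B_def by (intro span_base) blast
  have inner1: "inner (snd p) (snd q) = inner (fst p) (fst q)" if p: "p \<in> B" and q: "q \<in> span B" for p q
    using q
  proof (induction rule: span_induct_alt)
    case base
    then show ?case by simp
  next
    case (step c x y)
    obtain r a s b where "p = (r *\<^sub>C f a, r *\<^sub>C g a)" "x = (s *\<^sub>C f b, s *\<^sub>C g b)" "a \<in> A" "b \<in> A"
      using p step(1) unfolding B_def by blast
    then have "inner (snd p) (snd x) = inner (fst p) (fst x)"
      by (simp add: inner_eq_Re_cinner cinner_scaleC_left cinner_scaleC_right gram)
    with step(2) show ?case
      by (simp add: inner_add_right)
  qed
  have inner2: "inner (snd p) (snd q) = inner (fst p) (fst q)" if p: "p \<in> span B" and q: "q \<in> span B" for p q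
    using p
  proof (induction rule: span_induct_alt)
    case base
    then show ?case by simp
  next
    case (step c x y)
    with inner1[OF step(1) q] show ?case
      by (simp add: inner_add_left)
  qed
  have scale: "(c *\<^sub>C fst p, c *\<^sub>C snd p) \<in> span B" if "p \<in> span B" for c p
    using that
  proof (induction rule: span_induct_alt)
    case base
    then show ?case by (simp add: zero_prod_def[symmetric] span_zero)
  next
    case (step r x y)
    obtain s a where x: "x = (s *\<^sub>C f a, s *\<^sub>C g a)" "a \<in> A"
      using step(1) unfolding B_def by blast
    have "(c *\<^sub>C fst (r *\<^sub>R x + y), c *\<^sub>C snd (r *\<^sub>R x + y))
        = ((c * of_real r * s) *\<^sub>C f a, (c * of_real r * s) *\<^sub>C g a) + (c *\<^sub>C fst y, c *\<^sub>C snd y)"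
      by (simp add: x scaleR_scaleC scaleC_add_right scaleC_scaleC mult.assoc)
    then show ?case
      using span_add[OF inB[OF x(2)] step(2)] by metis
  qed
  show thesis
  proof (rule isometry_extension[of "span B"])
    show "norm y = norm x" if "(x, y) \<in> span B" for x y
      using inner2[OF that that] by (simp add: norm_eq_sqrt_inner)
    show "closure (fst ` span B) = UNIV"
    proof (rule dense_subspaceI)
      show "subspace (fst ` span B)"
        by (intro linear_subspace_image subspace_span bounded_linear.linear bounded_linear_fst)
      fix y :: 'a assume y: "\<And>s. s \<in> fst ` span B \<Longrightarrow> inner s y = 0"
      have "inner (c *\<^sub>C f a) y = 0" if "a \<in> A" for c a
        using inB[OF that] by (intro y) force
      from this[of _ 1] this[of _ \<i>] have "cinner (f a) y = 0" if "a \<in> A" for a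
        using that by (intro cinner_eq_0I) (auto simp: scaleC_one)
      then show "y = 0"
        using tot by (simp add: total_set_def)
    qed
    show "(x + x', y + y') \<in> span B" if "(x, y) \<in> span B" "(x', y') \<in> span B" for x y x' y'
      using span_add[OF that] by simp
    show "(c *\<^sub>C x, c *\<^sub>C y) \<in> span B" if "(x, y) \<in> span B" for c x y
      using scale[OF that] by simp
    show thesis if "linear_isometry L" "\<And>x y. (x, y) \<in> span B \<Longrightarrow> L x = y" for L
      using that(1) by (rule \<open>\<And>L. linear_isometry L \<Longrightarrow> (\<And>a. a \<in> A \<Longrightarrow> L (f a) = g a) \<Longrightarrow> thesis\<close>)
        (use that(2) inB[of _ 1] in \<open>simp add: scaleC_one\<close>)
  qed
qed

lemma total_imp_eq:
  assumes f: "linear_isometry f" and g: "linear_isometry g"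
    and eq: "\<And>x. x \<in> S \<Longrightarrow> f x = g x" and tot: "total_set S"
  shows "f = (g :: 'a::chilbert_space \<Rightarrow> 'a)"
proof (rule linear_isometry_ext[OF f g])
  let ?T = "{x. f x = g x}"
  show "f x = g x" if "x \<in> ?T" for x
    using that by simp
  show "closure ?T = UNIV"
  proof (rule dense_subspaceI)
    show "subspace ?T"
      using linear_isometry_linear[OF f] linear_isometry_linear[OF g]
      by (intro subspaceI) (auto simp: linear_0 linear_add linear_scale)
    fix y assume y: "\<And>s. s \<in> ?T \<Longrightarrow> inner s y = 0"
    \<comment> \<open>The set of agreement contains \<open>\<i> *\<^sub>C x\<close> along with
      \<open>x\<close>, which turns real orthogonality into complex orthogonality.\<close>
    have "cinner x y = 0" if "x \<in> S" for x
      using eq[OF that]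
      by (intro cinner_eq_0I y) (auto simp: linear_isometry_scaleC[OF f] linear_isometry_scaleC[OF g])
    then show "y = 0"
      using tot by (simp add: total_set_def)
  qed
qed

lemma closed_range_isometry:
  fixes f :: "'a::cbanach \<Rightarrow> 'b::cbanach"
  assumes f: "linear_isometry f"
  shows "closed (range f)"
proof (rule closed_sequential_limits[THEN iffD2], intro allI impI)
  fix y l assume "(\<forall>n. y n \<in> range f) \<and> y \<longlonglongrightarrow> l"
  then have l: "y \<longlonglongrightarrow> l" and "\<forall>n. \<exists>x. y n = f x"
    by auto
  then obtain x where x: "\<And>n. y n = f (x n)"
    using choice[of "\<lambda>n x. y n = f x"] by blast
  have "dist (x m) (x n) = dist (y m) (y n)" for m n
    by (simp add: x dist_norm linear_isometry_diff[OF f, symmetric] linear_isometry_norm[OF f])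
  then have "Cauchy x"
    using LIMSEQ_imp_Cauchy[OF l] by (simp add: Cauchy_def)
  then obtain z where "x \<longlonglongrightarrow> z"
    using Cauchy_convergent convergent_def by blast
  from linear_isometry_tendsto[OF f this] have "y \<longlonglongrightarrow> f z"
    by (simp flip: x)
  with l show "l \<in> range f"
    using LIMSEQ_unique by blast
qed

lemma surj_if_total_range:
  fixes f :: "'a::chilbert_space \<Rightarrow> 'a"
  assumes f: "linear_isometry f" and tot: "total_set (range f)"
  shows "surj f"
proof -
  have "closure (range f) = UNIV"
  proof (rule dense_subspaceI)
    show "subspace (range f)"
      by (intro linear_subspace_image linear_isometry_linear[OF f] subspace_UNIV)
    fix y assume y: "\<And>s. s \<in> range f \<Longrightarrow> inner s y = 0"
    have "cinner (f x) y = 0" for x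
      by (intro cinner_eq_0I y) (auto simp flip: linear_isometry_scaleC[OF f])
    then show "y = 0"
      using tot by (auto simp: total_set_def)
  qed
  then show ?thesis
    using closed_range_isometry[OF f] by simp
qed

lemma unitary_iff_surj:
  fixes V :: "'a::chilbert_space \<Rightarrow> 'a"
  assumes V: "linear_isometry V"
  shows "unitary V \<longleftrightarrow> surj V"
proof
  show "surj V" if "unitary V"
    using that unfolding unitary_def by (metis comp_apply id_apply surjI)
  assume "surj V"
  have "bounded_clinear V"
    unfolding bounded_clinear_def
    using V by (auto simp: linear_isometryD intro: exI[of _ 1])
  \<comment> \<open>Writing \<open>y\<close> as \<open>V (inv V y)\<close> and using that
    \<open>V\<close> preserves \<open>cinner\<close> shows that the inverse is the adjoint.\<close>
  moreover have "is_cadjoint V (inv V)"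
    unfolding is_cadjoint_def
    by (metis \<open>surj V\<close> linear_isometry_cinner[OF V] surj_f_inv_f)
  moreover have "inv V \<circ> V = id" "V \<circ> inv V = id"
    using linear_isometry_inj[OF V] \<open>surj V\<close> by (simp_all add: surj_iff)
  ultimately show "unitary V"
    unfolding unitary_def by blast
qed

section \<open>Semigroups from towers of square roots\<close>

instance cbanach \<subseteq> banach ..

section \<open>Limits of families of isometries\<close>

lemma summable_steps:
  fixes f :: "nat \<Rightarrow> 'a::banach"
  assumes a: "summable a" and step: "\<And>n. norm (f (Suc n) - f n) \<le> a n"
  shows summable_steps_convergent: "convergent f"
    and summable_steps_bound: "f \<longlonglongrightarrow> l \<Longrightarrow> norm (l - f n) \<le> (\<Sum>k. a (k + n))"
proof -
  have "summable (\<lambda>n. f (Suc n) - f n)"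
    by (rule summable_comparison_test'[OF a step])
  from summable_LIMSEQ[OF this] have "(\<lambda>n. f n - f 0) \<longlonglongrightarrow> (\<Sum>n. f (Suc n) - f n)"
    by (simp add: sum_lessThan_telescope)
  from tendsto_add[OF this tendsto_const[of "f 0"]] show "convergent f"
    by (auto simp: convergent_def)
  assume "f \<longlonglongrightarrow> l"
  then have sums: "(\<lambda>k. f (Suc k + n) - f (k + n)) sums (l - f n)"
    using telescope_sums[OF LIMSEQ_ignore_initial_segment, of f l n] by simp
  have a': "summable (\<lambda>k. a (k + n))"
    using a by (rule summable_ignore_initial_segment)
  have le: "norm (f (Suc k + n) - f (k + n)) \<le> a (k + n)" for k
    using step[of "k + n"] by simp
  have s: "summable (\<lambda>k. norm (f (Suc k + n) - f (k + n)))"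
    by (rule summable_comparison_test'[OF a']) (simp add: le del: add_Suc)
  show "norm (l - f n) \<le> (\<Sum>k. a (k + n))"
    using summable_norm[OF s] suminf_le[OF le s a'] sums_unique[OF sums] by simp
qed

text \<open>An isometry does not enlarge the error of approximating \<open>x\<close> by
  \<open>d\<close>, so convergence on a dense set suffices by an \<open>e / 3\<close>
  argument.\<close>

lemma isometries_tendsto_id:
  assumes iso: "eventually (\<lambda>t. linear_isometry (T t)) F"
    and conv: "\<And>x. x \<in> D \<Longrightarrow> ((\<lambda>t. T t x) \<longlongrightarrow> x) F"
    and dense: "closure D = UNIV"
  shows "((\<lambda>t. T t x) \<longlongrightarrow> x) F"
proof (rule tendstoI)
  fix e :: real assume "e > 0"
  then have "e / 3 > 0"
    by simp
  moreover have "x \<in> closure D"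
    using dense by simp
  ultimately obtain d where d: "d \<in> D" "dist d x < e / 3"
    using closure_approachable by blast
  have "eventually (\<lambda>t. dist (T t d) d < e / 3) F"
    using tendstoD[OF conv[OF d(1)] \<open>e / 3 > 0\<close>] .
  with iso show "eventually (\<lambda>t. dist (T t x) x < e) F"
  proof eventually_elim
    case (elim t)
    have "dist (T t x) (T t d) = dist x d"
      by (simp add: dist_norm linear_isometry_diff[OF elim(1), symmetric] linear_isometry_norm[OF elim(1)])
    moreover have "dist (T t x) x \<le> dist (T t x) (T t d) + dist (T t d) d + dist d x"
      using dist_triangle[of "T t x" x "T t d"] dist_triangle[of "T t d" x d] by simp
    ultimately show ?case
      using elim(2) d(2) by (simp add: dist_commute)
  qed
qed

lemma isometries_Cauchy:
  fixes T :: "nat \<Rightarrow> 'a::complex_normed_vector \<Rightarrow> 'b::complex_normed_vector"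
  assumes iso: "\<And>n. linear_isometry (T n)"
    and conv: "\<And>x. x \<in> D \<Longrightarrow> Cauchy (\<lambda>n. T n x)"
    and dense: "closure D = UNIV"
  shows "Cauchy (\<lambda>n. T n x)"
proof (rule metric_CauchyI)
  fix e :: real assume "e > 0"
  then have "e / 3 > 0"
    by simp
  moreover have "x \<in> closure D"
    using dense by simp
  ultimately obtain d where d: "d \<in> D" "dist d x < e / 3"
    using closure_approachable by blast
  obtain M where M: "\<And>m n. m \<ge> M \<Longrightarrow> n \<ge> M \<Longrightarrow> dist (T m d) (T n d) < e / 3"
    using metric_CauchyD[OF conv[OF d(1)] \<open>e / 3 > 0\<close>] by blast
  have iso': "dist (T n x) (T n y) = dist x y" for n x y
    by (simp add: dist_norm linear_isometry_diff[OF iso, symmetric] linear_isometry_norm[OF iso])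
  have "dist (T m x) (T n x) < e" if "m \<ge> M" "n \<ge> M" for m n
  proof -
    have "dist (T m x) (T n x) \<le> dist (T m x) (T m d) + dist (T m d) (T n d) + dist (T n d) (T n x)"
      using dist_triangle[of "T m x" "T n x" "T m d"] dist_triangle[of "T m d" "T n x" "T n d"] by simp
    also have "\<dots> < e"
      using M[OF that] d(2) by (simp add: iso' dist_commute)
    finally show ?thesis .
  qed
  then show "\<exists>M. \<forall>m\<ge>M. \<forall>n\<ge>M. dist (T m x) (T n x) < e"
    by blast
qed

lemma isometries_diagonal_tendsto:
  assumes iso: "\<And>n. linear_isometry (T n)"
    and "(\<lambda>n. T n y) \<longlonglongrightarrow> l" and "z \<longlonglongrightarrow> y"
  shows "(\<lambda>n. T n (z n)) \<longlonglongrightarrow> l"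
proof -
  have "(\<lambda>n. T n (z n) - T n y) \<longlonglongrightarrow> 0"
  proof (rule tendsto_norm_zero_cancel)
    have "norm (T n (z n) - T n y) = norm (z n - y)" for n
      by (metis linear_isometry_diff[OF iso] linear_isometry_norm[OF iso])
    then show "(\<lambda>n. norm (T n (z n) - T n y)) \<longlonglongrightarrow> 0"
      using tendsto_norm_zero[OF Lim_null[THEN iffD1, OF assms(3)]] by simp
  qed
  from tendsto_add[OF this assms(2)] show ?thesis
    by simp
qed

text \<open>The floor is additive up to a carry \<open>b\<close>, which later costs at most one
  additional factor of a root close to the identity.\<close>

lemma nat_floor_add_cases:
  fixes s t :: real
  assumes "s \<ge> 0" "t \<ge> 0"
  obtains b where "b \<le> 1" "nat \<lfloor>s + t\<rfloor> = nat \<lfloor>s\<rfloor> + nat \<lfloor>t\<rfloor> + b"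
proof (rule that[of "nat \<lfloor>s + t\<rfloor> - (nat \<lfloor>s\<rfloor> + nat \<lfloor>t\<rfloor>)"])
  have "\<lfloor>s\<rfloor> + \<lfloor>t\<rfloor> \<le> \<lfloor>s + t\<rfloor>" "\<lfloor>s + t\<rfloor> \<le> \<lfloor>s\<rfloor> + \<lfloor>t\<rfloor> + 1"
    by linarith+
  moreover have "\<lfloor>s\<rfloor> \<ge> 0" "\<lfloor>t\<rfloor> \<ge> 0"
    using assms by auto
  ultimately show "nat \<lfloor>s + t\<rfloor> - (nat \<lfloor>s\<rfloor> + nat \<lfloor>t\<rfloor>) \<le> 1"
    "nat \<lfloor>s + t\<rfloor> = nat \<lfloor>s\<rfloor> + nat \<lfloor>t\<rfloor> + (nat \<lfloor>s + t\<rfloor> - (nat \<lfloor>s\<rfloor> + nat \<lfloor>t\<rfloor>))"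
    by linarith+
qed

lemma funpow_le_1_dist:
  assumes "(b::nat) \<le> 1"
  shows "norm ((f ^^ b) x - x) \<le> norm (f x - x)"
  using assms by (cases b) auto

text \<open>\<open>V n\<close> plays the role of the semigroup at time
  \<open>1 / 2 ^ n\<close>.\<close>

locale root_tower =
  fixes V :: "nat \<Rightarrow> 'a::chilbert_space \<Rightarrow> 'a" and S :: "'a set"
  assumes iso: "linear_isometry (V n)"
    and sq: "V (Suc n) (V (Suc n) x) = V n x"
    and total_set: "total_set S"
    and summable: "x \<in> S \<Longrightarrow> summable (\<lambda>n. norm (V n x - x))"
begin

text \<open>Enlarges \<open>S\<close> to a subspace that is also stable under multiplication by
  \<open>\<i>\<close>; this makes it dense.\<close>

definition D :: "'a set"
  where "D = {x. summable (\<lambda>n. norm (V n x - x))}"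

lemma summable_D: "x \<in> D \<Longrightarrow> summable (\<lambda>n. norm (V (Suc n) x - x))"
  unfolding D_def by (simp add: summable_Suc_iff[of "\<lambda>n. norm (V n x - x)"])

lemma closure_D: "closure D = UNIV"
proof (rule dense_subspaceI)
  show "subspace D"
  proof (rule subspaceI)
    show "0 \<in> D"
      unfolding D_def by (simp add: linear_0[OF linear_isometry_linear[OF iso]])
  next
    fix x y assume "x \<in> D" "y \<in> D"
    then have "summable (\<lambda>n. norm (V n x - x) + norm (V n y - y))"
      unfolding D_def by (auto intro: summable_add)
    moreover have "norm (V n (x + y) - (x + y)) \<le> norm (V n x - x) + norm (V n y - y)" for n
      using norm_triangle_ineq[of "V n x - x" "V n y - y"]
      by (simp add: linear_isometry_add[OF iso] algebra_simps)
    ultimately show "x + y \<in> D"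
      unfolding D_def by (auto intro: summable_comparison_test'[where N = 0])
  next
    fix c x assume "x \<in> D"
    then have "summable (\<lambda>n. \<bar>c\<bar> * norm (V n x - x))"
      unfolding D_def by (auto intro: summable_mult)
    moreover have "norm (V n (c *\<^sub>R x) - c *\<^sub>R x) = \<bar>c\<bar> * norm (V n x - x)" for n
      by (simp add: linear_scale[OF linear_isometry_linear[OF iso]] flip: norm_scaleR scaleR_diff_right)
    ultimately show "c *\<^sub>R x \<in> D"
      unfolding D_def by simp
  qed
  fix y assume y: "\<And>s. s \<in> D \<Longrightarrow> inner s y = 0"
  have "cinner x y = 0" if "x \<in> S" for x
  proof (rule cinner_eq_0I)
    show "inner x y = 0"
      using summable[OF that] by (intro y) (simp add: D_def)
    have "norm (V n (\<i> *\<^sub>C x) - \<i> *\<^sub>C x) = norm (V n x - x)" for n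
      by (simp add: linear_isometry_scaleC[OF iso] norm_scaleC
          flip: complex_vector.scale_right_diff_distrib)
    then show "inner (\<i> *\<^sub>C x) y = 0"
      using summable[OF that] by (intro y) (simp add: D_def)
  qed
  then show "y = 0"
    using total_set by (simp add: total_set_def)
qed

text \<open>For \<open>t \<ge> 0\<close>, time is rounded down to a multiple of
  \<open>1 / 2 ^ n\<close>.\<close>

definition A :: "nat \<Rightarrow> real \<Rightarrow> 'a \<Rightarrow> 'a"
  where "A n t = V n ^^ nat \<lfloor>2 ^ n * t\<rfloor>"

lemma A_iso: "linear_isometry (A n t)"
  unfolding A_def by (rule linear_isometry_funpow[OF iso])

lemma A_0: "A n 0 = id"
  by (simp add: A_def)

lemma V_funpow_double: "V (Suc n) ^^ (2 * k) = V n ^^ k"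
proof -
  have "V (Suc n) ^^ 2 = V n"
    by (rule ext) (simp add: numeral_2_eq_2 sq)
  then show ?thesis
    using funpow_mult[where f = "V (Suc n)" and m = 2 and n = k] by (simp add: mult.commute)
qed

lemma A_1: "A n 1 = V 0"
proof (induction n)
  case 0
  show ?case
    by (simp add: A_def)
next
  case (Suc n)
  have "nat \<lfloor>2 ^ n :: real\<rfloor> = 2 ^ n" for n
    by (metis floor_of_nat nat_int of_nat_numeral of_nat_power)
  then have "A m 1 = V m ^^ 2 ^ m" for m
    by (simp only: A_def mult_1_right)
  from this[of n] this[of "Suc n"] Suc V_funpow_double[where n = n and k = "2 ^ n"] show ?case
    by simp
qed

text \<open>Doubling \<open>2 ^ n * t\<close> doubles its floor up to a carry \<open>b\<close>. The
  doubled part is a power of \<open>V n\<close>, so the two operators differ by the factor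
  \<open>V (Suc n) ^^ b\<close>, and the bound is uniform in \<open>t\<close>.\<close>

lemma A_step:
  assumes "t \<ge> 0"
  shows "norm (A (Suc n) t x - A n t x) \<le> norm (V (Suc n) x - x)"
proof -
  obtain b where b: "b \<le> 1" "nat \<lfloor>2 ^ n * t + 2 ^ n * t\<rfloor> = nat \<lfloor>2 ^ n * t\<rfloor> + nat \<lfloor>2 ^ n * t\<rfloor> + b"
    using nat_floor_add_cases[of "2 ^ n * t" "2 ^ n * t"] assms by auto
  have "A (Suc n) t = A n t \<circ> V (Suc n) ^^ b"
  proof -
    have "2 ^ Suc n * t = 2 ^ n * t + 2 ^ n * t"
      by simp
    then have "A (Suc n) t = V (Suc n) ^^ (2 * nat \<lfloor>2 ^ n * t\<rfloor> + b)"
      unfolding A_def b(2)[symmetric] mult_2 by (simp only:)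
    then show ?thesis
      by (simp only: funpow_add V_funpow_double A_def)
  qed
  then have "norm (A (Suc n) t x - A n t x) = norm ((V (Suc n) ^^ b) x - x)"
    by (simp add: linear_isometry_norm[OF A_iso] flip: linear_isometry_diff[OF A_iso])
  with funpow_le_1_dist[OF b(1)] show ?thesis
    by metis
qed

definition T :: "real \<Rightarrow> 'a \<Rightarrow> 'a"
  where "T t x = lim (\<lambda>n. A n t x)"

lemma A_tendsto:
  assumes "t \<ge> 0"
  shows "(\<lambda>n. A n t x) \<longlonglongrightarrow> T t x"
proof -
  have "Cauchy (\<lambda>n. A n t x)"
  proof (rule isometries_Cauchy[OF A_iso _ closure_D])
    fix x assume "x \<in> D"
    then show "Cauchy (\<lambda>n. A n t x)"
      using summable_steps_convergent[OF summable_D A_step[OF assms]] convergent_Cauchy by blast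
  qed
  then show ?thesis
    unfolding T_def using Cauchy_convergent convergent_LIMSEQ_iff by blast
qed

lemma T_iso:
  assumes "t \<ge> 0"
  shows "linear_isometry (T t)"
proof (rule linear_isometryI)
  note lim = A_tendsto[OF assms]
  show "T t (x + y) = T t x + T t y" for x y
    using tendsto_add[OF lim lim] lim[of "x + y"]
    by (auto simp: linear_isometry_add[OF A_iso] intro: LIMSEQ_unique)
  show "T t (c *\<^sub>C x) = c *\<^sub>C T t x" for c x
    using tendsto_scaleC[OF lim] lim[of "c *\<^sub>C x"]
    by (auto simp: linear_isometry_scaleC[OF A_iso] intro: LIMSEQ_unique)
  show "norm (T t x) = norm x" for x
    using tendsto_norm[OF lim, of x]
    by (simp add: linear_isometry_norm[OF A_iso] LIMSEQ_const_iff)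
qed

lemma V_tendsto: "(\<lambda>n. V n x) \<longlonglongrightarrow> x"
proof (rule isometries_tendsto_id[OF _ _ closure_D])
  show "(\<lambda>n. V n x) \<longlonglongrightarrow> x" if "x \<in> D" for x
    using summable_LIMSEQ_zero[of "\<lambda>n. norm (V n x - x)"] that
    by (simp add: D_def tendsto_norm_zero_iff Lim_null[symmetric])
qed (simp add: iso)

text \<open>The approximants satisfy the law up to the carry,
  \<open>A n (s + t) = A n s \<circ> A n t \<circ> V n ^^ b n\<close>, and the last factor tends
  strongly to the identity.\<close>

lemma T_add:
  assumes "s \<ge> 0" "t \<ge> 0"
  shows "T (s + t) x = T s (T t x)"
proof -
  have "\<exists>b\<le>1. nat \<lfloor>2 ^ n * (s + t)\<rfloor> = nat \<lfloor>2 ^ n * s\<rfloor> + nat \<lfloor>2 ^ n * t\<rfloor> + b" for n :: nat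
    using nat_floor_add_cases[of "2 ^ n * s" "2 ^ n * t"] assms by (auto simp: distrib_left)
  then obtain b :: "nat \<Rightarrow> nat" where b: "\<And>n. b n \<le> 1"
    "\<And>n. nat \<lfloor>2 ^ n * (s + t)\<rfloor> = nat \<lfloor>2 ^ n * s\<rfloor> + nat \<lfloor>2 ^ n * t\<rfloor> + b n"
    by metis
  have "(\<lambda>n. (V n ^^ b n) x - x) \<longlonglongrightarrow> 0"
    by (rule Lim_null_comparison[where g = "\<lambda>n. norm (V n x - x)"])
      (auto intro!: always_eventually funpow_le_1_dist b(1) tendsto_norm_zero
        V_tendsto[THEN Lim_null[THEN iffD1]])
  then have "(\<lambda>n. (V n ^^ b n) x) \<longlonglongrightarrow> x"
    using Lim_null by blast
  from isometries_diagonal_tendsto[OF A_iso A_tendsto[OF assms(2)] this]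
  have "(\<lambda>n. A n t ((V n ^^ b n) x)) \<longlonglongrightarrow> T t x" .
  from isometries_diagonal_tendsto[OF A_iso A_tendsto[OF assms(1)] this]
  have "(\<lambda>n. A n s (A n t ((V n ^^ b n) x))) \<longlonglongrightarrow> T s (T t x)" .
  moreover have "A n s (A n t ((V n ^^ b n) x)) = A n (s + t) x" for n
    by (simp add: A_def b(2) funpow_add)
  ultimately show ?thesis
    using A_tendsto[of "s + t" x] assms by (auto intro: LIMSEQ_unique)
qed

lemma T_tendsto_0: "((\<lambda>t. T t x) \<longlongrightarrow> x) (at_right 0)"
proof (rule isometries_tendsto_id[OF _ _ closure_D])
  show "\<forall>\<^sub>F t in at_right 0. linear_isometry (T t)"
    unfolding eventually_at_filter by (auto intro!: always_eventually T_iso)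
  fix x assume x: "x \<in> D"
  show "((\<lambda>t. T t x) \<longlongrightarrow> x) (at_right 0)"
  proof (rule tendstoI)
    fix e :: real assume "e > 0"
    \<comment> \<open>The tail from \<open>N\<close> on bounds the distance from
      \<open>A N t x\<close> to \<open>T t x\<close> uniformly in \<open>t\<close>; for
      \<open>t < 1 / 2 ^ N\<close> the exponent in \<open>A N t\<close> is 0.\<close>
    from suminf_exist_split[OF this summable_D[OF x]]
    obtain N where N: "norm (\<Sum>k. norm (V (Suc (k + N)) x - x)) < e"
      by auto
    have "dist (T t x) x < e" if t: "t > 0" "t < 1 / 2 ^ N" for t
    proof -
      have "\<lfloor>2 ^ N * t\<rfloor> = 0"
        using t by (simp add: floor_eq_iff field_simps)
      then have "A N t x = x"
        by (simp add: A_def)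
      with summable_steps_bound[OF summable_D[OF x] A_step A_tendsto, of t N] t N show ?thesis
        by (simp add: dist_norm)
    qed
    moreover have "\<forall>\<^sub>F t in at_right (0::real). t > 0 \<and> t < 1 / 2 ^ N"
      using eventually_at_right_real[of 0 "1 / 2 ^ N"] by simp
    ultimately show "\<forall>\<^sub>F t in at_right 0. dist (T t x) x < e"
      by (auto elim: eventually_mono)
  qed
qed

lemma continuous_T: "continuous_on {0..} (\<lambda>t. T t x)"
proof (rule continuous_onI)
  fix t e :: real assume t: "t \<in> {0..}" and e: "e > 0"
  from tendstoD[OF T_tendsto_0 e, of x]
  obtain d where d: "d > 0" "\<And>h. h > 0 \<Longrightarrow> h < d \<Longrightarrow> dist (T h x) x < e"
    unfolding eventually_at_right_field by auto
  \<comment> \<open>The isometry \<open>T s\<close> cancels, which reduces continuity everywhere,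
    from both sides, to the limit at 0.\<close>
  have shift: "dist (T r x) (T s x) < e" if "0 \<le> s" "s < r" "r - s < d" for r s
  proof -
    have "T r x - T s x = T s (T (r - s) x - x)"
      using T_add[of s "r - s" x] that by (simp add: linear_isometry_diff[OF T_iso])
    then have "dist (T r x) (T s x) = dist (T (r - s) x) x"
      using that by (simp add: dist_norm linear_isometry_norm[OF T_iso])
    with d(2)[of "r - s"] that show ?thesis
      by simp
  qed
  have "dist (T s x) (T t x) < e" if s: "s \<in> {0..}" "dist s t < d" for s
    using shift[of t s] shift[of s t] s t e
    by (cases s t rule: linorder_cases) (auto simp: dist_commute dist_real_def)
  with d(1) show "\<exists>d>0. \<forall>s\<in>{0..}. dist s t < d \<longrightarrow> dist (T s x) (T t x) \<le> e"
    by (meson less_imp_le)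
qed

lemma embeddable: "embeddable (V 0)"
  unfolding embeddable_def
proof (intro exI conjI)
  have "T 0 x = x" "T 1 x = V 0 x" for x
    using A_tendsto[of 0 x] A_tendsto[of 1 x]
    by (simp_all add: A_0 A_1 LIMSEQ_const_iff)
  then have "T 0 = id" "T 1 = V 0"
    by auto
  then show "V 0 = T 1"
    by simp
  show "C0_semigroup T"
    unfolding C0_semigroup_def bounded_clinear_def
    using \<open>T 0 = id\<close> continuous_T T_iso T_add
    by (auto simp: fun_eq_iff linear_isometryD intro: exI[of _ 1])
qed

end

section \<open>Square roots of unitary operators\<close>

text \<open>
  The square root is \<open>1 - Y\<close>, where \<open>Y = (X + Y\<^sup>2) / 2\<close> is found by fixed-point iteration. The
  increments of the iteration are dominated in norm by those of the same iteration for the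
  number \<open>1\<close>, which increases and is bounded by \<open>1\<close>.
\<close>

fun sqrt_iter :: "('a::real_vector \<Rightarrow> 'a) \<Rightarrow> nat \<Rightarrow> 'a \<Rightarrow> 'a"
  where
    "sqrt_iter X 0 x = 0"
  | "sqrt_iter X (Suc n) x = (1/2) *\<^sub>R (X x + sqrt_iter X n (sqrt_iter X n x))"

fun sqrt_iter_one :: "nat \<Rightarrow> real"
  where
    "sqrt_iter_one 0 = 0"
  | "sqrt_iter_one (Suc n) = (1 + sqrt_iter_one n * sqrt_iter_one n) / 2"

lemma sqrt_iter_one_bounds: "0 \<le> sqrt_iter_one n" "sqrt_iter_one n \<le> 1"
proof (induction n)
  case (Suc n)
  { case 1 then show ?case using Suc by simp }
  { case 2 then show ?case using Suc mult_mono[of "sqrt_iter_one n" 1 "sqrt_iter_one n" 1] by simp }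
qed auto

lemma sqrt_iter_one_mono: "sqrt_iter_one n \<le> sqrt_iter_one (Suc n)"
  using zero_le_square[of "1 - sqrt_iter_one n"] by (simp add: algebra_simps)

lemma summable_sqrt_iter_one: "summable (\<lambda>n. sqrt_iter_one (Suc n) - sqrt_iter_one n)"
proof -
  have "incseq sqrt_iter_one"
    using sqrt_iter_one_mono by (rule incseq_SucI)
  then have "convergent sqrt_iter_one"
    using sqrt_iter_one_bounds
    by (intro Bseq_mono_convergent BseqI'[of _ 1]) (auto dest: incseqD)
  then show ?thesis
    using telescope_summable convergent_def by blast
qed

text \<open>Applied below to \<open>1/2 - (U + I) / 4\<close>, where \<open>I\<close> is the inverse
  of a unitary \<open>U\<close>; the aim is a square root \<open>K\<close> of
  \<open>1 - X\<close>.\<close>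

locale contraction =
  fixes X :: "'a::chilbert_space \<Rightarrow> 'a"
  assumes clin: "clinear X"
    and norm_le: "norm (X x) \<le> norm x"
    and selfadj: "inner (X x) y = inner x (X y)"
begin

abbreviation "Y \<equiv> sqrt_iter X"

lemma clinear_Y: "clinear (Y n)"
proof (induction n)
  case 0
  show ?case
    by (rule clinearI) auto
next
  case (Suc n)
  note lin = linear_add[OF clinear_imp_linear]
  show ?case
    by (rule clinearI)
      (simp_all add: lin[OF Suc] lin[OF clin] clinear_scaleC[OF Suc] clinear_scaleC[OF clin]
        scaleR_scaleC scaleC_add_right scaleC_scaleC mult.commute)
qed

lemma Y_add: "Y n (x + y) = Y n x + Y n y"
  and Y_diff: "Y n (x - y) = Y n x - Y n y"
  using clinear_imp_linear[OF clinear_Y] by (auto simp: linear_add linear_diff)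

lemma norm_Y: "norm (Y n x) \<le> sqrt_iter_one n * norm x"
proof (induction n arbitrary: x)
  case (Suc n)
  have "norm (Y n (Y n x)) \<le> sqrt_iter_one n * (sqrt_iter_one n * norm x)"
    using Suc[of "Y n x"] mult_left_mono[OF Suc[of x] sqrt_iter_one_bounds(1)] by (rule order_trans)
  with norm_triangle_ineq[of "X x" "Y n (Y n x)"] norm_le[of x]
  have "norm (X x + Y n (Y n x)) \<le> (1 + sqrt_iter_one n * sqrt_iter_one n) * norm x"
    by (simp add: algebra_simps)
  then show ?case
    by simp
qed simp

lemma norm_Y_le: "norm (Y n x) \<le> norm x"
  using norm_Y[of n x] mult_right_mono[OF sqrt_iter_one_bounds(2), of "norm x" n] by simp

lemma selfadj_Y: "inner (Y n x) y = inner x (Y n y)"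
  by (induction n arbitrary: x y) (simp_all add: inner_add_left inner_add_right selfadj)

text \<open>With \<open>P = Y (Suc n)\<close> and \<open>Q = Y n\<close>, the identity
  \<open>P P - Q Q = P (P - Q) + (P - Q) Q\<close> reduces an increment to the previous one. The
  numbers \<open>sqrt_iter_one\<close> satisfy the same identity, so the bounds match
  exactly.\<close>

lemma norm_Y_step:
  "norm (Y (Suc n) x - Y n x) \<le> (sqrt_iter_one (Suc n) - sqrt_iter_one n) * norm x"
proof (induction n arbitrary: x)
  case 0
  show ?case
    using norm_le[of x] by simp
next
  case (Suc n)
  let ?y = sqrt_iter_one
  define d where "d = ?y (Suc n) - ?y n"
  have d: "d \<ge> 0" "norm (Y (Suc n) x - Y n x) \<le> d * norm x" for x
    using sqrt_iter_one_mono[of n] Suc by (auto simp: d_def simp del: sqrt_iter.simps sqrt_iter_one.simps)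
  have "norm (Y (Suc n) (Y (Suc n) x - Y n x)) \<le> ?y (Suc n) * (d * norm x)"
    by (rule order_trans[OF norm_Y]) (intro mult_left_mono d sqrt_iter_one_bounds)
  moreover have "norm (Y (Suc n) (Y n x) - Y n (Y n x)) \<le> d * (?y n * norm x)"
    by (rule order_trans[OF d(2)]) (intro mult_left_mono norm_Y d)
  moreover have "Y (Suc (Suc n)) x - Y (Suc n) x
      = (1/2) *\<^sub>R (Y (Suc n) (Y (Suc n) x - Y n x) + (Y (Suc n) (Y n x) - Y n (Y n x)))"
    unfolding Y_diff sqrt_iter.simps(2)[of X "Suc n" x] sqrt_iter.simps(2)[of X n x]
    by (simp add: algebra_simps)
  ultimately have "norm (Y (Suc (Suc n)) x - Y (Suc n) x)
      \<le> (1/2) * (?y (Suc n) * (d * norm x) + d * (?y n * norm x))"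
    using norm_triangle_ineq[of "Y (Suc n) (Y (Suc n) x - Y n x)" "Y (Suc n) (Y n x) - Y n (Y n x)"]
    by (simp del: sqrt_iter.simps sqrt_iter_one.simps)
  also have "\<dots> = (?y (Suc (Suc n)) - ?y (Suc n)) * norm x"
    unfolding d_def sqrt_iter_one.simps(2)[of "Suc n"] sqrt_iter_one.simps(2)[of n]
    by (simp add: field_simps)
  finally show ?case .
qed

definition Z :: "'a \<Rightarrow> 'a"
  where "Z x = lim (\<lambda>n. Y n x)"

lemma Y_tendsto: "(\<lambda>n. Y n x) \<longlonglongrightarrow> Z x"
  unfolding Z_def
  using summable_steps_convergent[OF summable_mult2[OF summable_sqrt_iter_one] norm_Y_step]
  by (simp add: convergent_LIMSEQ_iff)

lemma Z_fixed: "Z x = (1/2) *\<^sub>R (X x + Z (Z x))"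
proof -
  have "(\<lambda>n. Y n (Y n x) - Y n (Z x)) \<longlonglongrightarrow> 0"
  proof (rule Lim_null_comparison)
    show "\<forall>\<^sub>F n in sequentially. norm (Y n (Y n x) - Y n (Z x)) \<le> norm (Y n x - Z x)"
      using norm_Y_le by (simp flip: Y_diff)
    show "(\<lambda>n. norm (Y n x - Z x)) \<longlonglongrightarrow> 0"
      using Y_tendsto by (intro tendsto_norm_zero Lim_null[THEN iffD1])
  qed
  from tendsto_add[OF this Y_tendsto[of "Z x"]] have "(\<lambda>n. Y n (Y n x)) \<longlonglongrightarrow> Z (Z x)"
    by simp
  then have "(\<lambda>n. Y (Suc n) x) \<longlonglongrightarrow> (1/2) *\<^sub>R (X x + Z (Z x))"
    unfolding sqrt_iter.simps(2) by (intro tendsto_intros)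
  with Y_tendsto[of x] show ?thesis
    using LIMSEQ_Suc LIMSEQ_unique by blast
qed

text \<open>The nonnegative square root of \<open>1 - X\<close>, obtained by completing the square
  in \<open>2 Z = X + Z\<^sup>2\<close>.\<close>

definition K :: "'a \<Rightarrow> 'a"
  where "K x = x - Z x"

lemma clinear_Z: "clinear Z"
proof (rule clinearI)
  show "Z (x + y) = Z x + Z y" for x y
    using tendsto_add[OF Y_tendsto Y_tendsto] Y_tendsto[of "x + y"]
    by (auto simp: Y_add intro: LIMSEQ_unique)
  show "Z (c *\<^sub>C x) = c *\<^sub>C Z x" for c x
    using tendsto_scaleC[OF Y_tendsto] Y_tendsto[of "c *\<^sub>C x"]
    by (auto simp: clinear_scaleC[OF clinear_Y] intro: LIMSEQ_unique)
qed

lemma clinear_K: "clinear K"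
  using linear_add[OF clinear_imp_linear[OF clinear_Z]] clinear_scaleC[OF clinear_Z]
  by (intro clinearI) (simp_all add: K_def complex_vector.scale_right_diff_distrib)

lemma K_K: "K (K x) = x - X x"
proof -
  have "2 *\<^sub>R Z x = X x + Z (Z x)"
    using arg_cong[OF Z_fixed[of x], of "\<lambda>y. 2 *\<^sub>R y"] by simp
  then show ?thesis
    by (simp add: K_def linear_diff[OF clinear_imp_linear[OF clinear_Z]] scaleR_2 algebra_simps)
qed

lemma K_selfadj: "inner (K x) y = inner x (K y)"
proof -
  have "(\<lambda>n. inner (Y n x) y) \<longlonglongrightarrow> inner (Z x) y" "(\<lambda>n. inner x (Y n y)) \<longlonglongrightarrow> inner x (Z y)"
    by (intro tendsto_intros Y_tendsto)+
  then have "inner (Z x) y = inner x (Z y)"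
    using LIMSEQ_unique by (simp add: selfadj_Y)
  then show ?thesis
    by (simp add: K_def inner_diff_left inner_diff_right)
qed

lemma K_nonneg: "inner (K x) x \<ge> 0"
proof -
  have "norm (Z x) \<le> norm x"
    using tendsto_norm[OF Y_tendsto[of x]] norm_Y_le by (auto intro: LIMSEQ_le_const2)
  then have "inner (Z x) x \<le> norm x * norm x"
    using norm_cauchy_schwarz[of "Z x" x] mult_right_mono[of "norm (Z x)" "norm x" "norm x"] by simp
  then show ?thesis
    by (simp add: K_def inner_diff_left power2_norm_eq_inner[symmetric] power2_eq_square)
qed

text \<open>The iterates are polynomials in \<open>X\<close>, so an isometry commuting with
  \<open>X\<close> commutes with them and with their limit.\<close>

lemma K_commute:
  assumes U: "linear_isometry U" and comm: "\<And>x. U (X x) = X (U x)"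
  shows "U (K x) = K (U x)"
proof -
  have "U (Y n x) = Y n (U x)" for n x
    by (induction n arbitrary: x)
      (simp_all add: linear_0[OF linear_isometry_linear[OF U]] comm linear_isometry_add[OF U]
        linear_scale[OF linear_isometry_linear[OF U]])
  with linear_isometry_tendsto[OF U Y_tendsto[of x]] Y_tendsto[of "U x"] have "U (Z x) = Z (U x)"
    using LIMSEQ_unique by simp
  then show ?thesis
    by (simp add: K_def linear_isometry_diff[OF U])
qed

end

text \<open>
  The root is the unitary factor in the polar decomposition \<open>W K = C\<close> of \<open>C = (1 + U) / 2\<close>,
  extended by \<open>\<i>\<close> to the kernel of \<open>C\<close>, on which \<open>U = -1\<close>.
\<close>

lemma unitary_square_root:
  fixes U :: "'a::chilbert_space \<Rightarrow> 'a"
  assumes U: "linear_isometry U" and "surj U"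
  obtains W where "linear_isometry W" "\<And>x. W (W x) = U x"
    "\<And>x. 2 * (norm (W x - x))\<^sup>2 \<le> (norm (U x - x))\<^sup>2"
proof -
  define I where "I = inv U"
  have UI: "U (I x) = x" and IU: "I (U x) = x" for x
    unfolding I_def using \<open>surj U\<close> linear_isometry_inj[OF U] by (auto simp: surj_f_inv_f)
  note U_simps = linear_isometryD[OF U]
  have I: "linear_isometry I"
  proof (rule linear_isometryI)
    show "I (x + y) = I x + I y" for x y
      by (metis IU UI U_simps(3))
    show "I (c *\<^sub>C x) = c *\<^sub>C I x" for c :: complex and x :: 'a
      by (metis IU UI U_simps(5))
    show "norm (I x) = norm x" for x :: 'a
      by (metis UI U_simps(6))
  qed
  note I_simps = linear_isometryD[OF I]
  have U_adj: "inner (U x) y = inner x (I y)" for x y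
    by (metis UI linear_isometry_inner[OF U])
  \<comment> \<open>Chosen so that \<open>1 - X = C* C\<close> for \<open>C = (1 + U) / 2\<close>;
    then \<open>K\<close> is the absolute value of \<open>C\<close>.\<close>
  define X where "X x = (1/2) *\<^sub>R x - (1/4) *\<^sub>R (U x + I x)" for x
  interpret contraction X
  proof (rule contraction.intro)
    show "clinear X"
      by (rule clinearI)
        (simp_all add: X_def U_simps I_simps scaleR_scaleC scaleC_scaleC mult.commute algebra_simps
          scaleC_add_right complex_vector.scale_right_diff_distrib)
    show "norm (X x) \<le> norm x" for x
      using norm_triangle_ineq4[of "(1/2) *\<^sub>R x" "(1/4) *\<^sub>R (U x + I x)"] norm_triangle_ineq[of "U x" "I x"]
      by (simp add: X_def U_simps I_simps)
    show "inner (X x) y = inner x (X y)" for x y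
      using U_adj[of x y] U_adj[of y x]
      by (simp add: X_def inner_diff_left inner_diff_right inner_add_left inner_add_right inner_commute)
  qed
  define C where "C x = (1/2) *\<^sub>R (x + U x)" for x
  have C_add: "C (x + y) = C x + C y" and C_scale: "C (c *\<^sub>C x) = c *\<^sub>C C x" for x y c
    by (simp_all add: C_def U_simps scaleR_scaleC scaleC_scaleC mult.commute algebra_simps scaleC_add_right)
  have K_add: "K (x + y) = K x + K y" and K_scale: "K (c *\<^sub>C x) = c *\<^sub>C K x" for x y c
    using linear_add[OF clinear_imp_linear[OF clinear_K]] clinear_scaleC[OF clinear_K] by auto
  have K_scaleR: "K (r *\<^sub>R x) = r *\<^sub>R K x" for r x
    by (simp add: scaleR_scaleC K_scale)
  have "U (X x) = X (U x)" for x
    by (simp add: X_def U_simps linear_scale UI IU)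
  then have UK: "U (K x) = K (U x)" for x
    by (rule K_commute[OF U])
  have CK: "C (K x) = K (C x)" for x
    by (simp add: C_def K_add K_scaleR UK)
  have KK: "4 *\<^sub>R K (K x) = 2 *\<^sub>R x + (U x + I x)" for x
  proof -
    have "4 *\<^sub>R x = 2 *\<^sub>R x + 2 *\<^sub>R x"
      by (simp flip: scaleR_add_left)
    then show ?thesis
      by (simp add: K_K X_def algebra_simps)
  qed
  \<comment> \<open>The adjoint of \<open>C\<close> is \<open>I C\<close>, so
    \<open>C C = U C* C = U K K\<close>.\<close>
  have CC: "C (C x) = U (K (K x))" for x
  proof -
    have "4 *\<^sub>R C (C x) = U (2 *\<^sub>R x + (U x + I x))"
      by (simp add: C_def U_simps linear_scale UI algebra_simps scaleR_2)
    also have "\<dots> = 4 *\<^sub>R U (K (K x))"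
      by (simp add: KK[symmetric] linear_scale[OF U_simps(2)])
    finally show ?thesis
      by simp
  qed
  have inner_C: "inner (C x) (C y) = inner (K x) (K y)" for x y
  proof -
    have "4 * inner (C x) (C y) = inner (2 *\<^sub>R x + (U x + I x)) y"
      using U_adj[of y x] by (simp add: C_def inner_add_left inner_add_right linear_isometry_inner[OF U]
          inner_commute algebra_simps)
    also have "\<dots> = 4 * inner (K x) (K y)"
      by (simp add: KK[symmetric] K_selfadj)
    finally show ?thesis
      by simp
  qed
  \<comment> \<open>The kernel of \<open>K\<close>, which by \<open>inner_C\<close> is also the
    kernel of \<open>C\<close>.\<close>
  define N where "N = {z. K z = 0}"
  have N_add: "z + z' \<in> N" and N_scale: "c *\<^sub>C z \<in> N" if "z \<in> N" "z' \<in> N" for z z' c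
    using that by (simp_all add: N_def K_add K_scale)
  have UN: "U z = - z" if "z \<in> N" for z
  proof -
    have "C z = 0"
      using inner_C[of z z] that by (simp add: N_def)
    then show ?thesis
      by (simp add: C_def add_eq_0_iff)
  qed
  have CN: "inner (C x) z = 0" if "z \<in> N" for x z
    using linear_isometry_inner[OF U, of x z] UN[OF that] by (simp add: C_def inner_add_left)
  have KN: "inner (K x) z = 0" if "z \<in> N" for x z
    using that by (simp add: N_def K_selfadj)
  \<comment> \<open>The graph of \<open>W\<close> on \<open>range K + N\<close>. Both sums are
    orthogonal by \<open>KN\<close> and \<open>CN\<close>, so \<open>inner_C\<close> makes the map
    isometric.\<close>
  define G where "G = {(K x + z, C x + \<i> *\<^sub>C z) | x z. z \<in> N}"
  \<comment> \<open>Used with the identity for the domain of \<open>W\<close>, and with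
    \<open>F = K\<close> for a smaller domain on which \<open>W\<close> can be computed twice, since
    \<open>C (K x) = K (C x)\<close> lies in the range of \<open>K\<close> again.\<close>
  have dense: "closure {K (F x) + z | x z. z \<in> N} = UNIV"
    if F: "linear F" and FN: "\<And>y. (\<And>x. inner (K (F x)) y = 0) \<Longrightarrow> y \<in> N" for F
  proof (rule dense_subspaceI)
    note F_simps = linear_0[OF F] linear_add[OF F] linear_scale[OF F]
    have K0: "K 0 = 0"
      using K_add[of 0 0] by simp
    show "subspace {K (F x) + z | x z. z \<in> N}"
    proof (rule subspaceI)
      show "0 \<in> {K (F x) + z | x z. z \<in> N}"
        by (auto simp: F_simps K0 N_def intro!: exI[of _ 0])
    next
      fix u v assume "u \<in> {K (F x) + z | x z. z \<in> N}" "v \<in> {K (F x) + z | x z. z \<in> N}"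
      then obtain x z x' z' where "u = K (F x) + z" "v = K (F x') + z'" "z \<in> N" "z' \<in> N"
        by blast
      then have "u + v = K (F (x + x')) + (z + z')" "z + z' \<in> N"
        by (auto simp: F_simps K_add N_add)
      then show "u + v \<in> {K (F x) + z | x z. z \<in> N}"
        by blast
    next
      fix r u assume "u \<in> {K (F x) + z | x z. z \<in> N}"
      then obtain x z where "u = K (F x) + z" "z \<in> N"
        by blast
      then have "r *\<^sub>R u = K (F (r *\<^sub>R x)) + r *\<^sub>R z" "r *\<^sub>R z \<in> N"
        by (auto simp: F_simps K_scaleR scaleR_add_right N_def)
      then show "r *\<^sub>R u \<in> {K (F x) + z | x z. z \<in> N}"
        by blast
    qed
    fix y assume y: "\<And>s. s \<in> {K (F x) + z | x z. z \<in> N} \<Longrightarrow> inner s y = 0"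
    have "0 \<in> N"
      by (simp add: N_def K0)
    then have "inner (K (F x) + 0) y = 0" for x
      by (intro y) blast
    then have "y \<in> N"
      by (intro FN) simp
    then have "inner (K (F 0) + y) y = 0"
      by (intro y) blast
    then show "y = 0"
      by (simp add: F_simps K0)
  qed
  have dense1: "closure {K x + z | x z. z \<in> N} = UNIV"
  proof (rule dense[of "\<lambda>x. x"])
    fix y assume "\<And>x. inner (K x) y = 0"
    from this[of "K y"] show "y \<in> N"
      by (simp add: N_def K_selfadj[of "K y"])
  qed (simp add: linear_id[unfolded id_def])
  have dense2: "closure {K (K x) + z | x z. z \<in> N} = UNIV"
  proof (rule dense[OF clinear_imp_linear[OF clinear_K]])
    fix y assume "\<And>x. inner (K (K x)) y = 0"
    from this[of y] show "y \<in> N"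
      by (simp add: N_def K_selfadj[of "K y"])
  qed
  obtain W where W: "linear_isometry W" and WG: "\<And>u v. (u, v) \<in> G \<Longrightarrow> W u = v"
  proof (rule isometry_extension[of G])
    fix u v u' v' assume "(u, v) \<in> G" "(u', v') \<in> G"
    then obtain x z x' z' where "z \<in> N" "z' \<in> N"
      "u = K x + z" "v = C x + \<i> *\<^sub>C z" "u' = K x' + z'" "v' = C x' + \<i> *\<^sub>C z'"
      unfolding G_def by blast
    then have "z + z' \<in> N" "u + u' = K (x + x') + (z + z')" "v + v' = C (x + x') + \<i> *\<^sub>C (z + z')"
      by (auto simp: N_add K_add C_add scaleC_add_right)
    then show "(u + u', v + v') \<in> G"
      unfolding G_def by blast
  next
    fix c u v assume "(u, v) \<in> G"
    then obtain x z where "z \<in> N" "u = K x + z" "v = C x + \<i> *\<^sub>C z"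
      unfolding G_def by blast
    then have "c *\<^sub>C z \<in> N" "c *\<^sub>C u = K (c *\<^sub>C x) + c *\<^sub>C z" "c *\<^sub>C v = C (c *\<^sub>C x) + \<i> *\<^sub>C (c *\<^sub>C z)"
      by (auto simp: N_scale K_scale C_scale scaleC_add_right scaleC_scaleC mult.commute)
    then show "(c *\<^sub>C u, c *\<^sub>C v) \<in> G"
      unfolding G_def by blast
  next
    fix u v assume "(u, v) \<in> G"
    then obtain x z where *: "z \<in> N" "u = K x + z" "v = C x + \<i> *\<^sub>C z"
      unfolding G_def by blast
    have "(norm v)\<^sup>2 = (norm u)\<^sup>2"
      unfolding * norm_add_Pythagorean
      using CN[OF N_scale[OF *(1) *(1)], of x \<i>] KN[OF *(1), of x] inner_C[of x x]
      by (simp add: power2_norm_eq_inner inner_add_left inner_add_right inner_commute norm_scaleC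
          flip: power2_norm_eq_inner[of "\<i> *\<^sub>C z"])
    then show "norm v = norm u"
      by simp
  next
    have "fst ` G = {K x + z | x z. z \<in> N}"
      unfolding G_def by force
    then show "closure (fst ` G) = UNIV"
      using dense1 by simp
  next
    fix L assume "linear_isometry L" "\<And>u v. (u, v) \<in> G \<Longrightarrow> L u = v"
    then show thesis
      by (rule that)
  qed
  have W_eq: "W (K x + z) = C x + \<i> *\<^sub>C z" if "z \<in> N" for x z
    using that by (intro WG) (auto simp: G_def)
  have WK: "W (K x) = C x" for x
    using W_eq[of 0 x] K_add[of 0 0] by (simp add: N_def)
  have WN: "W z = \<i> *\<^sub>C z" if "z \<in> N" for z
    using W_eq[OF that, of 0] K_add[of 0 0] C_add[of 0 0] by simp
  have "W \<circ> W = U"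
  proof (rule linear_isometry_ext[OF linear_isometry_compose[OF W W] U _ dense2])
    fix u assume "u \<in> {K (K x) + z | x z. z \<in> N}"
    then obtain x z where u: "u = K (K x) + z" "z \<in> N"
      by blast
    have "W (W (K (K x))) = U (K (K x))"
      by (simp add: WK CK CC)
    moreover have "W (W z) = U z"
      using u(2) by (simp add: WN N_scale scaleC_scaleC UN)
    ultimately show "(W \<circ> W) u = U u"
      by (simp add: u(1) linear_isometry_add[OF W] U_simps)
  qed
  then have WW: "W (W x) = U x" for x
    by (metis comp_apply)
  \<comment> \<open>Continuity reduces this to the dense domain. The factor \<open>\<i>\<close> on
    \<open>N\<close> contributes nothing to the real part.\<close>
  have "inner (W x) x \<ge> 0" for x
  proof (rule continuous_ge_on_closure[where S = "{K x + z | x z. z \<in> N}"])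
    show "continuous_on (closure {K x + z | x z. z \<in> N}) (\<lambda>x. inner (W x) x)"
      by (intro continuous_intros linear_isometry_continuous[OF W])
    show "x \<in> closure {K x + z | x z. z \<in> N}"
      using dense1 by simp
    fix u assume "u \<in> {K x + z | x z. z \<in> N}"
    then obtain x z where u: "u = K x + z" "z \<in> N"
      by blast
    have "inner (\<i> *\<^sub>C z) z = 0"
      by (simp add: inner_eq_Re_cinner cinner_scaleC_left cinner_self)
    moreover have "inner (\<i> *\<^sub>C z) (K x) = 0"
      using KN[OF N_scale[OF u(2) u(2)]] by (simp add: inner_commute)
    \<comment> \<open>\<open>K\<close> is self-adjoint and commutes with the inverse
      \<open>I\<close>, so \<open>U x\<close> and \<open>I x\<close> have the same inner product
      with \<open>K x\<close>, and \<open>2 (x + U x)\<close> may be replaced by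
      \<open>2 x + U x + I x\<close>. Nonnegativity of \<open>K\<close> at \<open>K x\<close> then
      applies.\<close>
    moreover have "4 * inner (C x) (K x) = inner (4 *\<^sub>R K (K x)) (K x)"
    proof -
      have "inner (U x) (K x) = inner (I x) (K x)"
      proof -
        have "I (K x) = K (I x)"
          using UK[of "I x"] IU[of "K (I x)"] UI[of x] by simp
        then show ?thesis
          by (simp only: U_adj K_selfadj[of x "I x", symmetric] inner_commute[of "K x" "I x"])
      qed
      then show ?thesis
        unfolding KK by (simp add: C_def inner_add_left)
    qed
    ultimately show "inner (W u) u \<ge> 0"
      using K_nonneg[of "K x"] CN[OF u(2), of x]
      by (simp add: u W_eq inner_add_left inner_add_right)
  qed
  then have pos: "inner (W y) y \<ge> 0" for y .
  have "2 * (norm (W x - x))\<^sup>2 \<le> (norm (U x - x))\<^sup>2" for x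
  proof -
    \<comment> \<open>In \<open>U x - x = W y + y\<close> the cross term is nonnegative and both
      summands have the same norm, which gives the factor 2.\<close>
    define y where "y = W x - x"
    have "U x - x = W y + y"
      by (simp add: y_def linear_isometry_diff[OF W] WW)
    then have "(norm (U x - x))\<^sup>2 = (norm (W y))\<^sup>2 + (norm y)\<^sup>2 + 2 * inner (W y) y"
      by (simp add: power2_norm_eq_inner inner_add_left inner_add_right inner_commute)
    with pos[of y] show ?thesis
      by (simp add: linear_isometry_norm[OF W] y_def)
  qed
  with W WW show thesis
    by (rule that)
qed

text \<open>Each root at least halves the squared distance to the identity, so the distances decay
  geometrically with ratio \<open>1 / sqrt 2\<close>. They are bounded by multiples of
  \<open>norm (U x - x)\<close>, hence fixed vectors of \<open>U\<close> stay fixed.\<close>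

lemma unitary_root_tower:
  fixes U :: "'a::chilbert_space \<Rightarrow> 'a"
  assumes U: "linear_isometry U" and surj: "surj U"
  obtains W where "W 0 = U" "\<And>n. linear_isometry (W n)"
    "\<And>n x. W (Suc n) (W (Suc n) x) = W n x"
    "\<And>x. summable (\<lambda>n. norm (W n x - x))"
    "\<And>n x. U x = x \<Longrightarrow> W n x = x"
proof -
  have "\<exists>W :: nat \<Rightarrow> 'a \<Rightarrow> 'a. \<forall>n. (linear_isometry (W n) \<and> surj (W n) \<and> (n = 0 \<longrightarrow> W n = U)) \<and>
    ((\<forall>x. W (Suc n) (W (Suc n) x) = W n x) \<and>
     (\<forall>x. 2 * (norm (W (Suc n) x - x))\<^sup>2 \<le> (norm (W n x - x))\<^sup>2))"
  proof (rule dependent_nat_choice)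
    show "\<exists>W. linear_isometry W \<and> surj W \<and> (0 = (0::nat) \<longrightarrow> W = U)"
      using assms by blast
  next
    fix W :: "'a \<Rightarrow> 'a" and n :: nat
    assume "linear_isometry W \<and> surj W \<and> (n = 0 \<longrightarrow> W = U)"
    then obtain W' where W': "linear_isometry W'" "\<And>x. W' (W' x) = W x"
      "\<And>x. 2 * (norm (W' x - x))\<^sup>2 \<le> (norm (W x - x))\<^sup>2" and "surj W"
      using unitary_square_root[of W] by metis
    then have "surj W'"
      by (metis surj_def)
    with W' show "\<exists>W'. (linear_isometry W' \<and> surj W' \<and> (Suc n = 0 \<longrightarrow> W' = U)) \<and>
        (\<forall>x. W' (W' x) = W x) \<and> (\<forall>x. 2 * (norm (W' x - x))\<^sup>2 \<le> (norm (W x - x))\<^sup>2)"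
      by blast
  qed
  then obtain W :: "nat \<Rightarrow> 'a \<Rightarrow> 'a" where W: "\<And>n. linear_isometry (W n)" "W 0 = U"
    "\<And>n x. W (Suc n) (W (Suc n) x) = W n x"
    and step: "\<And>n x. 2 * (norm (W (Suc n) x - x))\<^sup>2 \<le> (norm (W n x - x))\<^sup>2"
    by blast
  have bound: "norm (W n x - x) \<le> (1 / sqrt 2) ^ n * norm (U x - x)" for n x
  proof (induction n)
    case 0
    show ?case
      by (simp add: W(2))
  next
    case (Suc n)
    have "(sqrt 2 * norm (W (Suc n) x - x))\<^sup>2 \<le> (norm (W n x - x))\<^sup>2"
      using step[of n x] by (simp add: power_mult_distrib)
    then have "sqrt 2 * norm (W (Suc n) x - x) \<le> norm (W n x - x)"
      by (rule power2_le_imp_le) simp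
    then have "norm (W (Suc n) x - x) \<le> 1 / sqrt 2 * norm (W n x - x)"
      by (simp add: field_simps)
    also have "\<dots> \<le> 1 / sqrt 2 * ((1 / sqrt 2) ^ n * norm (U x - x))"
      by (intro mult_left_mono Suc) simp
    finally show ?case
      by simp
  qed
  show thesis
  proof (rule that[of W])
    fix x
    have "1 < sqrt 2"
      by simp
    then have "summable (\<lambda>n. (1 / sqrt 2) ^ n * norm (U x - x))"
      by (intro summable_mult2 summable_geometric) simp
    then show "summable (\<lambda>n. norm (W n x - x))"
      using bound by (auto intro: summable_comparison_test'[where N = 0])
  next
    fix n x
    assume "U x = x"
    with bound[of n x] show "W n x = x"
      by simp
  qed (use W in auto)
qed

section \<open>The codimension of the range of an embeddable isometry\<close>

lemma coset_eqD:
  assumes "coset (range V) x = coset (range V) y" and "clinear V"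
  obtains z where "x = y + V z"
proof -
  have "V 0 = 0"
    using linear_0 clinear_imp_linear assms(2) by blast
  then have "x \<in> coset (range V) x"
    unfolding coset_def by force
  with assms(1) show thesis
    using that unfolding coset_def by auto
qed

lemma coset_add_range:
  assumes "clinear V"
  shows "coset (range V) (x + V z) = coset (range V) x"
proof -
  note lin = clinear_imp_linear[OF assms]
  have eq: "x + V z + V m = x + V (z + m)" "x + V m = x + V z + V (m - z)" for m
    by (simp_all add: linear_add[OF lin] linear_diff[OF lin])
  have "coset (range V) y = range (\<lambda>m. y + V m)" for y
    unfolding coset_def by auto
  then show ?thesis
    using eq by (metis (no_types, lifting) rangeI image_subsetI subset_antisym)
qed

text \<open>Modulo the range of \<open>S\<close> only the term with \<open>a 0\<close> survives, and
  \<open>e\<close> lies outside that range, so \<open>a 0 = 0\<close>; injectivity then cancels one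
  factor \<open>S\<close>.\<close>

lemma wandering_independent:
  fixes S :: "'a::complex_vector \<Rightarrow> 'a"
  assumes S: "clinear S" "inj S" and e: "e \<notin> range S"
    and "(\<Sum>k<n. a k *\<^sub>C (S ^^ k) e) = (S ^^ n) w" "k < n"
  shows "a k = 0"
  using assms(4,5)
proof (induction n arbitrary: a k)
  case (Suc n)
  note lin = clinear_imp_linear[OF S(1)]
  let ?s = "\<Sum>k<n. a (Suc k) *\<^sub>C (S ^^ k) e"
  have "(\<Sum>k<Suc n. a k *\<^sub>C (S ^^ k) e) = a 0 *\<^sub>C e + S ?s"
    by (simp add: sum.lessThan_Suc_shift linear_sum[OF lin] clinear_scaleC[OF S(1)] del: sum.lessThan_Suc)
  with Suc.prems have eq: "a 0 *\<^sub>C e + S ?s = S ((S ^^ n) w)"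
    by simp
  have "a 0 = 0"
  proof (rule ccontr)
    assume "a 0 \<noteq> 0"
    have "a 0 *\<^sub>C e = S ((S ^^ n) w - ?s)"
      using eq by (simp add: linear_diff[OF lin] algebra_simps)
    then have "e = S (inverse (a 0) *\<^sub>C ((S ^^ n) w - ?s))"
      using \<open>a 0 \<noteq> 0\<close> by (simp add: clinear_scaleC[OF S(1)] scaleC_scaleC scaleC_one flip: \<open>a 0 *\<^sub>C e = _\<close>)
    with e show False
      by blast
  qed
  with eq have "?s = (S ^^ n) w"
    using S(2) by (simp add: inj_eq)
  with Suc.IH[of "\<lambda>k. a (Suc k)"] Suc.prems(2) \<open>a 0 = 0\<close> show ?case
    by (cases k) auto
qed simp

text \<open>Representatives of the cosets of the \<open>v k\<close> can be taken in the span of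
  \<open>B\<close>; they inherit independence, but there is one more of them than \<open>B\<close>
  has elements.\<close>

lemma not_finite_quotient_basis_if_independent:
  fixes V :: "'a::complex_vector \<Rightarrow> 'a" and v :: "nat \<Rightarrow> 'a"
  assumes V: "clinear V"
    and indep: "\<And>a w k. (\<Sum>k<Suc (card B). a k *\<^sub>C v k) = V w \<Longrightarrow> k < Suc (card B) \<Longrightarrow> a k = 0"
  shows "\<not> finite_quotient_basis (range V) B"
proof
  let ?n = "Suc (card B)"
  assume "finite_quotient_basis (range V) B"
  then have "finite B" and "\<forall>k. \<exists>c. coset (range V) (v k) = coset (range V) (\<Sum>b\<in>B. c b *\<^sub>C b)"
    unfolding finite_quotient_basis_def by auto
  then obtain c where c: "\<And>k. coset (range V) (v k) = coset (range V) (\<Sum>b\<in>B. c k b *\<^sub>C b)"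
    by metis
  define y where "y k = (\<Sum>b\<in>B. c k b *\<^sub>C b)" for k
  have "\<forall>k. \<exists>z. v k = y k + V z"
    using c coset_eqD[OF _ V] unfolding y_def by metis
  then obtain z where z: "\<And>k. v k = y k + V (z k)"
    by metis
  have zero: "a k = 0" if "(\<Sum>k<?n. a k *\<^sub>C y k) = 0" "k < ?n" for a k
  proof (rule indep[OF _ that(2)])
    have "(\<Sum>k<?n. a k *\<^sub>C v k) = (\<Sum>k<?n. a k *\<^sub>C y k) + (\<Sum>k<?n. V (a k *\<^sub>C z k))"
      by (simp only: z scaleC_add_right sum.distrib clinear_scaleC[OF V])
    then show "(\<Sum>k<?n. a k *\<^sub>C v k) = V (\<Sum>k<?n. a k *\<^sub>C z k)"
      by (simp only: that(1) linear_sum[OF clinear_imp_linear[OF V]] add_0)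
  qed
  \<comment> \<open>Coinciding representatives would satisfy a relation with coefficients 1 and -1.
    Distinctness gives the cardinality of the image.\<close>
  have inj: "inj_on y {..<?n}"
  proof (rule inj_onI, rule ccontr)
    fix i j assume ij: "i \<in> {..<?n}" "j \<in> {..<?n}" "y i = y j" "i \<noteq> j"
    define a :: "nat \<Rightarrow> complex" where "a k = (if k = i then 1 else if k = j then -1 else 0)" for k
    have "(\<Sum>k<?n. a k *\<^sub>C y k) = (\<Sum>k\<in>{i, j}. a k *\<^sub>C y k)"
      using ij by (intro sum.mono_neutral_right) (auto simp: a_def)
    also have "\<dots> = 0"
      using ij by (simp add: a_def scaleC_one)
    finally have "a i = 0"
      using zero[of a i] ij by simp
    then show False
      by (simp add: a_def)
  qed
  have "complex_vector.independent (y ` {..<?n})"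
  proof
    assume "complex_vector.dependent (y ` {..<?n})"
    then obtain u k where u: "(\<Sum>x\<in>y ` {..<?n}. u x *\<^sub>C x) = 0" "k < ?n" "u (y k) \<noteq> 0"
      by (auto simp: complex_vector.dependent_finite)
    then have "(\<Sum>k<?n. u (y k) *\<^sub>C y k) = 0"
      by (simp only: sum.reindex[OF inj] comp_def)
    with zero[of "\<lambda>k. u (y k)" k] u show False
      by simp
  qed
  moreover have "y ` {..<?n} \<subseteq> complex_vector.span B"
    unfolding y_def
    by (auto intro: complex_vector.span_sum complex_vector.span_scale complex_vector.span_base)
  ultimately have "card (y ` {..<?n}) \<le> card B"
    using complex_vector.independent_span_bound[OF \<open>finite B\<close>] by blast
  then show False
    by (simp add: card_image[OF inj])
qed

lemma C0_semigroup_funpow: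
  assumes T: "C0_semigroup T" and "t \<ge> 0"
  shows "T (real k * t) = T t ^^ k"
proof (induction k)
  case 0
  show ?case
    using T by (simp add: C0_semigroup_def)
next
  case (Suc k)
  have "T (t + real k * t) = T t \<circ> T (real k * t)"
    using T \<open>t \<ge> 0\<close> unfolding C0_semigroup_def by simp
  then show ?case
    by (simp add: Suc distrib_right)
qed

lemma codim_range_if_embeddable:
  fixes V :: "'a::cbanach \<Rightarrow> 'a"
  assumes V: "linear_isometry V" and "embeddable V" and "\<not> surj V"
  shows "codim (range V) = \<infinity>"
  unfolding codim_eq_infinity_iff
proof
  assume "\<exists>B. finite_quotient_basis (range V) B"
  then obtain B where B: "finite_quotient_basis (range V) B"
    by blast
  obtain T where T: "C0_semigroup T" and VT: "V = T 1"
    using \<open>embeddable V\<close> unfolding embeddable_def by blast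
  \<comment> \<open>One more than the size of the supposed basis, so that the vectors
    \<open>(S ^^ k) e\<close> with \<open>k < n\<close> are too many.\<close>
  define n where "n = Suc (card B)"
  define S where "S = T (1 / real n)"
  have S: "clinear S"
    using T unfolding S_def C0_semigroup_def bounded_clinear_def by simp
  have VS: "V = S ^^ n"
    using C0_semigroup_funpow[OF T, of "1 / real n" n] by (simp add: VT S_def n_def)
  have "inj S"
    using linear_isometry_inj[OF V] unfolding VS n_def funpow_Suc_right by (rule inj_on_imageI2)
  moreover have "\<not> surj S"
    using \<open>\<not> surj V\<close> surj_fn unfolding VS by blast
  then obtain e where "e \<notin> range S"
    by blast
  ultimately have "\<not> finite_quotient_basis (range V) B"
    using wandering_independent[OF S] linear_isometry_clinear[OF V] unfolding VS n_def
    by (intro not_finite_quotient_basis_if_independent[where v = "\<lambda>k. (S ^^ k) e"]) blast+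
  with B show False
    by blast
qed

section \<open>Isometries whose range has infinite codimension\<close>

definition corthonormal :: "'a::complex_inner set \<Rightarrow> bool"
  where "corthonormal E \<longleftrightarrow> (\<forall>x\<in>E. \<forall>y\<in>E. cinner x y = (if x = y then 1 else 0))"

lemma cinner_add_right: "cinner x (y + z) = cinner x y + cinner x z"
  by (metis cinner_add_left cinner_commute complex_cnj_add)

lemma cinner_scaleR_left: "cinner (r *\<^sub>R x) y = of_real r * cinner x y"
  and cinner_scaleR_right: "cinner x (r *\<^sub>R y) = of_real r * cinner x y"
  by (simp_all add: scaleR_scaleC cinner_scaleC_left cinner_scaleC_right)

lemma cinner_zero_left: "cinner 0 x = 0"
  using cinner_scaleR_left[of 0 0 x] by simp

lemma cinner_diff_left: "cinner (x - y) z = cinner x z - cinner y z"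
  using cinner_add_left[of "x - y" y z] by simp

lemma cinner_diff_right: "cinner x (y - z) = cinner x y - cinner x z"
  using cinner_add_right[of x "y - z" z] by simp

lemma cinner_sum_left: "cinner (\<Sum>i\<in>A. f i) y = (\<Sum>i\<in>A. cinner (f i) y)"
  by (induction A rule: infinite_finite_induct) (simp_all add: cinner_zero_left cinner_add_left)

lemma cinner_eq_0_commute: "cinner x y = 0 \<longleftrightarrow> cinner y x = 0"
  by (metis cinner_commute complex_cnj_zero)

lemma cinner_self_eq_0: "cinner x x = 0 \<longleftrightarrow> x = 0"
  by (simp add: cinner_self)

text \<open>Glues two partial isometries with orthogonal domains and orthogonal images:
  \<open>A <+> B\<close> indexes the joint Gram matrix, whose mixed entries vanish.\<close>

lemma isometry_from_orthogonal_grams: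
  fixes f f' :: "'i \<Rightarrow> 'a::chilbert_space" and g g' :: "'j \<Rightarrow> 'a"
  assumes f: "\<And>a a'. a \<in> A \<Longrightarrow> a' \<in> A \<Longrightarrow> cinner (f' a) (f' a') = cinner (f a) (f a')"
    and g: "\<And>b b'. b \<in> B \<Longrightarrow> b' \<in> B \<Longrightarrow> cinner (g' b) (g' b') = cinner (g b) (g b')"
    and gf: "\<And>a b. b \<in> B \<Longrightarrow> a \<in> A \<Longrightarrow> cinner (g b) (f a) = 0"
    and gf': "\<And>a b. b \<in> B \<Longrightarrow> a \<in> A \<Longrightarrow> cinner (g' b) (f' a) = 0"
    and tot: "total_set (f ` A \<union> g ` B)"
  obtains L where "linear_isometry L" "\<And>a. a \<in> A \<Longrightarrow> L (f a) = f' a" "\<And>b. b \<in> B \<Longrightarrow> L (g b) = g' b"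
proof (rule isometry_from_gram[of "A <+> B" "case_sum f' g'" "case_sum f g"])
  have fg: "cinner (f a) (g b) = 0" "cinner (f' a) (g' b) = 0" if "b \<in> B" "a \<in> A" for a b
    using gf[OF that] gf'[OF that] cinner_eq_0_commute by blast+
  show "cinner (case_sum f' g' x) (case_sum f' g' y) = cinner (case_sum f g x) (case_sum f g y)"
    if "x \<in> A <+> B" "y \<in> A <+> B" for x y
    using that by (auto simp: f g gf gf' fg)
  have "case_sum f g ` (A <+> B) = f ` A \<union> g ` B"
    by (auto simp: Plus_def image_Un image_image)
  then show "total_set (case_sum f g ` (A <+> B))"
    using tot by simp
  fix L assume "linear_isometry L" "\<And>x. x \<in> A <+> B \<Longrightarrow> L (case_sum f g x) = case_sum f' g' x"
  then show thesis
    using that by (metis InlI InrI old.sum.simps(5,6))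
qed

text \<open>Zorn's lemma yields a maximal orthonormal set in the orthogonal complement of the range;
  the last property expresses its completeness there.\<close>

lemma wandering_basis_exists:
  fixes V :: "'a::chilbert_space \<Rightarrow> 'a"
  assumes V: "linear_isometry V"
  obtains E where "corthonormal E" "\<And>e x. e \<in> E \<Longrightarrow> cinner e (V x) = 0"
    "\<And>x. (\<And>e. e \<in> E \<Longrightarrow> cinner e x = 0) \<Longrightarrow> x \<in> range V"
proof -
  define \<E> where "\<E> = {E. corthonormal E \<and> (\<forall>e\<in>E. \<forall>x. cinner e (V x) = 0)}"
  have "\<exists>E\<in>\<E>. \<forall>F\<in>\<E>. E \<subseteq> F \<longrightarrow> F = E"
  proof (rule subset_Zorn')
    fix C assume C: "subset.chain \<E> C"
    have "cinner x y = (if x = y then 1 else 0)" if xy: "x \<in> \<Union>C" "y \<in> \<Union>C" for x y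
    proof -
      obtain A B where AB: "A \<in> C" "x \<in> A" "B \<in> C" "y \<in> B"
        using xy by blast
      then have "A \<subseteq> B \<or> B \<subseteq> A"
        using subset.chain_total[OF C] by blast
      with AB obtain F where "F \<in> C" "x \<in> F" "y \<in> F"
        by blast
      then show ?thesis
        using C unfolding subset.chain_def \<E>_def corthonormal_def by blast
    qed
    moreover have "cinner e (V x) = 0" if "e \<in> \<Union>C" for e x
      using that C unfolding subset.chain_def \<E>_def by blast
    ultimately show "\<Union>C \<in> \<E>"
      unfolding \<E>_def corthonormal_def by blast
  qed
  then obtain E where E: "E \<in> \<E>" and max: "\<And>F. F \<in> \<E> \<Longrightarrow> E \<subseteq> F \<Longrightarrow> F = E"
    by blast
  have orth: "corthonormal E" and perp: "\<And>e x. e \<in> E \<Longrightarrow> cinner e (V x) = 0"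
    using E unfolding \<E>_def by auto
  have "x \<in> range V" if x: "\<And>e. e \<in> E \<Longrightarrow> cinner e x = 0" for x
  proof -
    have "subspace (range V)"
      by (intro linear_subspace_image linear_isometry_linear[OF V] subspace_UNIV)
    then obtain z where z: "\<And>s. s \<in> range V \<Longrightarrow> inner (x - V z) s = 0"
      using orthogonal_projection_exists[OF _ closed_range_isometry[OF V]] by (metis rangeE)
    \<comment> \<open>The component of \<open>x\<close> orthogonal to the range; if nonzero, its
      normalisation could be added to \<open>E\<close>.\<close>
    define w where "w = x - V z"
    have wV: "cinner w (V y) = 0" for y
      using z unfolding w_def[symmetric] cinner_eq_inner
      by (simp add: complex_eq_iff flip: linear_isometry_scaleC[OF V])
    have wE: "cinner e w = 0" if "e \<in> E" for e
      using x[OF that] perp[OF that, of z] by (simp add: w_def cinner_diff_right)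
    have "w = 0"
    proof (rule ccontr)
      assume "w \<noteq> 0"
      define u where "u = (1 / norm w) *\<^sub>R w"
      have uu: "cinner u u = 1"
        using \<open>w \<noteq> 0\<close> by (simp add: u_def cinner_scaleR_left cinner_scaleR_right cinner_self power2_eq_square)
      have uE: "cinner e u = 0" "cinner u e = 0" if "e \<in> E" for e
        using wE[OF that] cinner_eq_0_commute[of w e]
        by (simp_all add: u_def cinner_scaleR_left cinner_scaleR_right)
      have "cinner u (V y) = 0" for y
        by (simp add: u_def cinner_scaleR_left wV)
      then have "insert u E \<in> \<E>"
        using orth perp uu uE unfolding \<E>_def corthonormal_def by auto
      then have "u \<in> E"
        using max by blast
      then show False
        using uE uu by simp
    qed
    then show ?thesis
      by (simp add: w_def)
  qed
  with orth perp show thesis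
    by (rule that)
qed

text \<open>Inner products with elements of \<open>E\<close> read off coordinates and vanish on the
  range; subtracting the expansion \<open>s\<close> leaves a vector of the range.\<close>

lemma finite_quotient_basis_if_wandering_basis:
  fixes V :: "'a::chilbert_space \<Rightarrow> 'a"
  assumes V: "linear_isometry V" and E: "corthonormal E" "finite E"
    and perp: "\<And>e x. e \<in> E \<Longrightarrow> cinner e (V x) = 0"
    and range: "\<And>x. (\<And>e. e \<in> E \<Longrightarrow> cinner e x = 0) \<Longrightarrow> x \<in> range V"
  shows "finite_quotient_basis (range V) E"
proof -
  note clin = linear_isometry_clinear[OF V]
  have coord: "cinner (\<Sum>b\<in>E. c b *\<^sub>C b) e = c e" if "e \<in> E" for c e
  proof -
    have "cinner (\<Sum>b\<in>E. c b *\<^sub>C b) e = (\<Sum>b\<in>E. if b = e then c b else 0)"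
      using E(1) that unfolding cinner_sum_left corthonormal_def
      by (intro sum.cong) (simp_all add: cinner_scaleC_left)
    then show ?thesis
      using \<open>finite E\<close> that by simp
  qed
  have "c e = 0"
    if eq: "coset (range V) (\<Sum>b\<in>E. c b *\<^sub>C b) = coset (range V) 0" and e: "e \<in> E" for c e
  proof -
    obtain z where "(\<Sum>b\<in>E. c b *\<^sub>C b) = 0 + V z"
      by (rule coset_eqD[OF eq clin])
    then show ?thesis
      using coord[OF e, of c] perp[OF e, of z] cinner_eq_0_commute[of e] by simp
  qed
  moreover have "\<exists>c. coset (range V) x = coset (range V) (\<Sum>b\<in>E. c b *\<^sub>C b)" for x
  proof -
    define s where "s = (\<Sum>b\<in>E. cinner x b *\<^sub>C b)"
    have "cinner (x - s) e = 0" if "e \<in> E" for e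
      using coord[OF that] by (simp add: s_def cinner_diff_left)
    then have "cinner e (x - s) = 0" if "e \<in> E" for e
      using that cinner_eq_0_commute by blast
    then obtain z where "x - s = V z"
      using range by blast
    then have "x = s + V z"
      by (simp add: algebra_simps)
    then have "coset (range V) x = coset (range V) s"
      by (simp add: coset_add_range[OF clin])
    then show ?thesis
      unfolding s_def by (intro exI[of _ "cinner x"])
  qed
  ultimately show ?thesis
    using \<open>finite E\<close> unfolding finite_quotient_basis_def by simp
qed

lemma bij_betw_Times_nat_exists:
  assumes "infinite A"
  obtains f :: "'a \<times> nat \<Rightarrow> 'a" where "bij_betw f (A \<times> UNIV) A"
proof -
  have "(card_of (A \<times> (UNIV :: nat set)), card_of A) \<in> ordIso"
    using assms infinite_iff_card_of_nat card_of_Times_infinite[of A "UNIV :: nat set"] by blast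
  then show thesis
    using that card_of_ordIso by blast
qed

text \<open>The exponent is the position of the leading binary digit. This makes the numbering of
  Haar functions in \<open>h\<close> injective.\<close>

lemma pow2_add_eq_iff:
  fixes r r' :: nat
  assumes "2 ^ m + r = 2 ^ m' + r'" "r < 2 ^ m" "r' < 2 ^ m'"
  shows "m = m' \<and> r = r'"
proof -
  have False if "a < b" "2 ^ a + s = 2 ^ b + s'" "s < 2 ^ a" for a b s s' :: nat
  proof -
    have "(2::nat) ^ Suc a \<le> 2 ^ b"
      using that(1) by (intro power_increasing) auto
    with that show False
      by simp
  qed
  from this[of m m' r r'] this[of m' m r' r] assms show ?thesis
    by (cases m m' rule: linorder_cases) auto
qed

text \<open>
  The vectors \<open>e i n\<close> form an orthonormal basis of the orthogonal complement of the range of \<open>V\<close>.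
  For each \<open>i\<close> the vectors \<open>(V ^^ k) (e i n)\<close> play the role of the Haar basis of \<open>L\<^sup>2\<close> on the half
  line: \<open>(V ^^ k) (e i 0)\<close> is the indicator of the interval from \<open>k\<close> to \<open>k + 1\<close>,
  \<open>h i m k\<close> is the Haar function on the dyadic interval from \<open>k / 2\<^sup>m\<close> to \<open>(k + 1) / 2\<^sup>m\<close>, and
  \<open>d i m k\<close> is the normalised indicator of that interval. Translation by \<open>1\<close> is \<open>V\<close>, and
  translation by \<open>1 / 2\<^sup>n\<close> is its \<open>2\<^sup>n\<close>-th root.
\<close>

locale haar =
  fixes V :: "'a::chilbert_space \<Rightarrow> 'a" and I :: "'i set" and e :: "'i \<Rightarrow> nat \<Rightarrow> 'a"
  assumes V: "linear_isometry V"
    and e_orth: "i \<in> I \<Longrightarrow> j \<in> I \<Longrightarrow> cinner (e i m) (e j n) = (if i = j \<and> m = n then 1 else 0)"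
    and e_perp: "i \<in> I \<Longrightarrow> cinner (e i n) (V x) = 0"
    and e_range: "(\<And>i n. i \<in> I \<Longrightarrow> cinner (e i n) x = 0) \<Longrightarrow> x \<in> range V"
begin

section \<open>The Haar system and its Gram relations\<close>

definition v :: "'i \<Rightarrow> nat \<Rightarrow> nat \<Rightarrow> 'a"
  where "v i k n = (V ^^ k) (e i n)"

text \<open>\<open>k div 2 ^ m\<close> selects the unit interval containing the dyadic one. Within
  it the Haar functions are numbered level by level, with \<open>2 ^ m + r\<close> for position
  \<open>r\<close> at level \<open>m\<close>; number 0 is reserved for the indicator in
  \<open>d\<close>.\<close>

definition h :: "'i \<Rightarrow> nat \<Rightarrow> nat \<Rightarrow> 'a"
  where "h i m k = v i (k div 2 ^ m) (2 ^ m + k mod 2 ^ m)"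

text \<open>The parent's indicator plus or minus its Haar function lives on one half: the left one
  for even \<open>k\<close>, the right one for odd \<open>k\<close>.\<close>

fun d :: "'i \<Rightarrow> nat \<Rightarrow> nat \<Rightarrow> 'a"
  where
    "d i 0 k = v i k 0"
  | "d i (Suc m) k = (1 / sqrt 2) *\<^sub>R (d i m (k div 2) + (-1) ^ k *\<^sub>R h i m (k div 2))"

lemma V_v: "V (v i k n) = v i (Suc k) n"
  by (simp add: v_def)

lemma v_orth:
  assumes "i \<in> I" "j \<in> I"
  shows "cinner (v i k m) (v j l n) = (if i = j \<and> k = l \<and> m = n then 1 else 0)"
proof (induction k arbitrary: l)
  case 0
  show ?case
    using assms by (cases l) (auto simp: v_def e_orth e_perp)
next
  case (Suc k)
  show ?case
  proof (cases l)
    case 0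
    then have "cinner (v j l n) (v i (Suc k) m) = 0"
      using e_perp[OF assms(2)] by (simp add: v_def)
    with 0 show ?thesis
      by (simp add: cinner_eq_0_commute)
  next
    case (Suc l')
    then show ?thesis
      using Suc.IH[of l'] linear_isometry_cinner[OF V, of "v i k m" "v j l' n"] by (simp add: V_v)
  qed
qed

lemma h_orth:
  assumes "i \<in> I" "j \<in> I"
  shows "cinner (h i m k) (h j p l) = (if i = j \<and> m = p \<and> k = l then 1 else 0)"
proof -
  have "m = p \<and> k = l" if "k div 2 ^ m = l div 2 ^ p" "2 ^ m + k mod 2 ^ m = 2 ^ p + l mod 2 ^ p"
    using pow2_add_eq_iff[OF that(2)] that(1) by (metis mod_less_divisor div_mult_mod_eq zero_less_numeral zero_less_power)
  then show ?thesis
    unfolding h_def v_orth[OF assms] by auto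
qed

text \<open>\<open>d i m k\<close> is built only from indicators of unit intervals and Haar
  functions of levels below \<open>m\<close>.\<close>

lemma d_h_orth:
  assumes "i \<in> I" "j \<in> I" "m \<le> p"
  shows "cinner (d i m k) (h j p l) = 0"
  using assms(3)
proof (induction m arbitrary: k)
  case 0
  show ?case
    by (simp add: h_def v_orth assms)
next
  case (Suc m)
  then show ?case
    by (simp add: cinner_scaleR_left cinner_add_left h_orth assms)
qed

lemma h_d_orth: "i \<in> I \<Longrightarrow> j \<in> I \<Longrightarrow> m \<le> p \<Longrightarrow> cinner (h j p l) (d i m k) = 0"
  using d_h_orth cinner_eq_0_commute by blast

lemma d_orth:
  assumes "i \<in> I" "j \<in> I"
  shows "cinner (d i m k) (d j m l) = (if i = j \<and> k = l then 1 else 0)"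
proof (induction m arbitrary: k l)
  case 0
  show ?case
    by (simp add: v_orth assms)
next
  case (Suc m)
  have sqrt2: "complex_of_real (sqrt 2) * complex_of_real (sqrt 2) = 2"
    by (simp flip: of_real_mult)
  \<comment> \<open>The mixed terms vanish by \<open>d_h_orth\<close>; the remaining two add up for
    \<open>k = l\<close> and cancel for siblings.\<close>
  have "cinner (d i (Suc m) k) (d j (Suc m) l)
      = (1 / 2) * (cinner (d i m (k div 2)) (d j m (l div 2))
        + (-1) ^ k * (-1) ^ l * cinner (h i m (k div 2)) (h j m (l div 2)))"
    by (simp add: cinner_scaleR_left cinner_scaleR_right cinner_add_left cinner_add_right
        d_h_orth h_d_orth assms sqrt2 field_simps)
  also have "\<dots> = (if i = j \<and> k div 2 = l div 2 then (1 / 2) * (1 + (-1) ^ k * (-1) ^ l) else 0)"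
    by (simp add: Suc h_orth assms)
  also have "\<dots> = (if i = j \<and> k = l then 1 else 0)"
  proof (cases "k div 2 = l div 2")
    case True
    then show ?thesis
      by (cases "even k"; cases "even l") (auto elim!: evenE oddE)
  qed auto
  finally show ?case .
qed

text \<open>Dyadic intervals are nested or disjoint, and each halving costs a factor
  \<open>1 / sqrt 2\<close>. The value depends on the nesting and the level difference, both
  preserved by translations.\<close>

lemma d_gram:
  assumes "i \<in> I" "j \<in> I"
  shows "cinner (d i m k) (d j (m + p) l)
    = (if i = j \<and> l div 2 ^ p = k then of_real ((1 / sqrt 2) ^ p) else 0)"
proof (induction p arbitrary: l)
  case 0
  show ?case
    by (auto simp: d_orth assms)
next
  case (Suc p)
  show ?case
    by (simp add: cinner_scaleR_right cinner_add_right d_h_orth assms Suc div_mult2_eq)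
qed

text \<open>The recursion for \<open>d\<close> solved for the parent: coarse vectors are recovered
  from finer ones.\<close>

lemma d_split: "d i m k = (1 / sqrt 2) *\<^sub>R (d i (Suc m) (2 * k) + d i (Suc m) (2 * k + 1))"
  and h_split: "h i m k = (1 / sqrt 2) *\<^sub>R (d i (Suc m) (2 * k) - d i (Suc m) (2 * k + 1))"
  by (simp_all flip: scaleR_add_right scaleR_diff_right scaleR_2)

declare d.simps(2) [simp del]

lemma V_h: "V (h i m k) = h i m (k + 2 ^ m)"
  by (simp add: h_def V_v)

lemma V_d: "V (d i m k) = d i m (k + 2 ^ m)"
proof (induction m arbitrary: k)
  case 0
  show ?case
    by (simp add: V_v)
next
  case (Suc m)
  note lin = linear_isometry_linear[OF V]
  have "(k + 2 ^ Suc m) div 2 = k div 2 + 2 ^ m"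
    by simp
  moreover have "(-1::real) ^ (k + 2 ^ Suc m) = (-1) ^ k"
    by (simp add: power_add)
  ultimately show ?case
    by (simp only: d.simps linear_scale[OF lin] linear_add[OF lin] Suc V_h)
qed

section \<open>The Wold decomposition, with unitary summand \<open>H\<^sub>u\<close>\<close>

definition H\<^sub>u :: "'a set"
  where "H\<^sub>u = {x. \<forall>i\<in>I. \<forall>k n. cinner (v i k n) x = 0}"

lemma H\<^sub>uD: "x \<in> H\<^sub>u \<Longrightarrow> i \<in> I \<Longrightarrow> cinner (v i k n) x = 0"
  by (simp add: H\<^sub>u_def)

lemma H\<^sub>u_d: "x \<in> H\<^sub>u \<Longrightarrow> i \<in> I \<Longrightarrow> cinner (d i m k) x = 0"
  by (induction m arbitrary: k)
    (simp_all add: d.simps(2) H\<^sub>uD h_def cinner_scaleR_left cinner_add_left)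

lemma total_d: "total_set (H\<^sub>u \<union> {d i m k | i m k. i \<in> I \<and> n \<le> m})"
  unfolding total_set_def
proof (intro allI impI)
  fix y assume "\<forall>x\<in>H\<^sub>u \<union> {d i m k | i m k. i \<in> I \<and> n \<le> m}. cinner x y = 0"
  then have y: "\<And>x. x \<in> H\<^sub>u \<Longrightarrow> cinner x y = 0"
    and d_ge: "\<And>i m k. i \<in> I \<Longrightarrow> n \<le> m \<Longrightarrow> cinner (d i m k) y = 0"
    by blast+
  have "cinner (d i m k) y = 0" if "i \<in> I" "n \<le> m + p" for i m k p
    using that(2)
  proof (induction p arbitrary: m k)
    case 0
    then show ?case
      by (simp add: d_ge that(1))
  next
    case (Suc p)
    then have "cinner (d i (Suc m) k) y = 0" for k
      by simp
    then show ?case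
      by (simp add: d_split[of i m k] cinner_scaleR_left cinner_add_left)
  qed
  then have d: "cinner (d i m k) y = 0" if "i \<in> I" for i m k
    using that le_add2 by blast
  then have h: "cinner (h i m k) y = 0" if "i \<in> I" for i m k
    using that by (simp add: h_split[of i m k] cinner_scaleR_left cinner_diff_left)
  have "cinner (v i k n) y = 0" if i: "i \<in> I" for i k n
  proof (cases "n = 0")
    case True
    then show ?thesis
      using d[OF i, of 0 k] by simp
  next
    case False
    \<comment> \<open>Every positive index is \<open>2 ^ m + r\<close> with
      \<open>r < 2 ^ m\<close>, hence the number of a Haar function.\<close>
    then obtain m where m: "2 ^ m \<le> n" "n < 2 ^ Suc m"
      using ex_power_ivl1[of 2 n] by auto
    define r where "r = n - 2 ^ m"
    have r: "n = 2 ^ m + r" "r < 2 ^ m"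
      using m by (auto simp: r_def)
    then have "h i m (k * 2 ^ m + r) = v i k n"
      by (simp add: h_def)
    then show ?thesis
      using h[OF i] by metis
  qed
  then have "y \<in> H\<^sub>u"
    by (simp add: H\<^sub>u_def)
  from y[OF this] show "y = 0"
    by (simp add: cinner_self_eq_0)
qed

lemma V_H\<^sub>u: "x \<in> H\<^sub>u \<Longrightarrow> V x \<in> H\<^sub>u"
  unfolding H\<^sub>u_def
proof safe
  fix i k n assume x: "\<forall>i\<in>I. \<forall>k n. cinner (v i k n) x = 0" and i: "i \<in> I"
  show "cinner (v i k n) (V x) = 0"
  proof (cases k)
    case 0
    then show ?thesis
      by (simp add: v_def e_perp i)
  next
    case (Suc l)
    then show ?thesis
      using x i by (simp add: linear_isometry_cinner[OF V] flip: V_v)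
  qed
qed

lemma H\<^sub>u_range:
  assumes "y \<in> H\<^sub>u"
  obtains x where "x \<in> H\<^sub>u" "V x = y"
proof -
  have "cinner (e i n) y = 0" if "i \<in> I" for i n
    using H\<^sub>uD[OF assms that, of 0 n] by (simp add: v_def)
  then obtain x where x: "y = V x"
    using e_range by blast
  have "cinner (v i k n) x = 0" if "i \<in> I" for i k n
    using H\<^sub>uD[OF assms that, of "Suc k" n] by (simp add: x linear_isometry_cinner[OF V] flip: V_v)
  then have "x \<in> H\<^sub>u"
    by (simp add: H\<^sub>u_def)
  with x show thesis
    using that by blast
qed

text \<open>The unitary restriction of \<open>V\<close> to \<open>H\<^sub>u\<close> is extended by
  the identity, so that the root tower for unitaries of the whole space applies.\<close>

lemma unitary_part:
  obtains U where "linear_isometry U" "surj U" "\<And>x. x \<in> H\<^sub>u \<Longrightarrow> U x = V x"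
    "\<And>i k n. i \<in> I \<Longrightarrow> U (v i k n) = v i k n"
proof -
  define B :: "('i \<times> nat \<times> nat) set" where "B = {(i, k, n). i \<in> I}"
  define f where "f = (\<lambda>(i, k, n). v i k n)"
  obtain U where U: "linear_isometry U" and UV: "\<And>x. x \<in> H\<^sub>u \<Longrightarrow> U x = V x"
    and Uf: "\<And>b. b \<in> B \<Longrightarrow> U (f b) = f b"
  proof (rule isometry_from_orthogonal_grams[of H\<^sub>u V "\<lambda>x. x" B f f])
    show "cinner (f b) x = 0" if "b \<in> B" "x \<in> H\<^sub>u" for b x
      using that H\<^sub>uD unfolding f_def B_def by auto
    show "cinner (f b) (V x) = 0" if "b \<in> B" "x \<in> H\<^sub>u" for b x
      using that H\<^sub>uD V_H\<^sub>u unfolding f_def B_def by auto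
    show "total_set ((\<lambda>x. x) ` H\<^sub>u \<union> f ` B)"
      unfolding total_set_def
    proof (intro allI impI)
      fix y assume y: "\<forall>x\<in>(\<lambda>x. x) ` H\<^sub>u \<union> f ` B. cinner x y = 0"
      have "v i k n \<in> f ` B" if "i \<in> I" for i k n
        using that unfolding f_def B_def by force
      with y have "y \<in> H\<^sub>u"
        unfolding H\<^sub>u_def by blast
      with y show "y = 0"
        using cinner_self_eq_0[of y] by blast
    qed
    fix L assume "linear_isometry L" "\<And>x. x \<in> H\<^sub>u \<Longrightarrow> L x = V x" "\<And>b. b \<in> B \<Longrightarrow> L (f b) = f b"
    then show thesis
      by (rule that)
  qed (simp_all add: linear_isometry_cinner[OF V])
  have Uv: "U (v i k n) = v i k n" if "i \<in> I" for i k n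
    using Uf[of "(i, k, n)"] that by (simp add: B_def f_def)
  have "total_set (range U)"
    unfolding total_set_def
  proof (intro allI impI)
    fix y assume y: "\<forall>x\<in>range U. cinner x y = 0"
    then have "cinner (v i k n) y = 0" if "i \<in> I" for i k n
      using Uv[OF that] by (metis rangeI)
    then have "y \<in> H\<^sub>u"
      by (simp add: H\<^sub>u_def)
    then obtain x where "x \<in> H\<^sub>u" "V x = y"
      by (rule H\<^sub>u_range)
    then have "y \<in> range U"
      using UV by (metis rangeI)
    with y show "y = 0"
      using cinner_self_eq_0 by blast
  qed
  with U UV Uv show thesis
    using surj_if_total_range that by blast
qed

lemma embeddable: "embeddable V"
proof -
  obtain U where U: "linear_isometry U" "surj U" and UV: "\<And>x. x \<in> H\<^sub>u \<Longrightarrow> U x = V x"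
    and Uv: "\<And>i k n. i \<in> I \<Longrightarrow> U (v i k n) = v i k n"
    using unitary_part by blast
  obtain W where W0: "W 0 = U" and W: "\<And>n. linear_isometry (W n)"
    and WW: "\<And>n x. W (Suc n) (W (Suc n) x) = W n x"
    and W_summable: "\<And>x. summable (\<lambda>n. norm (W n x - x))"
    and W_fix: "\<And>n x. U x = x \<Longrightarrow> W n x = x"
    by (rule unitary_root_tower[OF U]) (rule that)
  \<comment> \<open>\<open>W n\<close> fixes every \<open>v i k l\<close> because \<open>U\<close>
    does, and so preserves orthogonality to them.\<close>
  have W_H\<^sub>u: "W n x \<in> H\<^sub>u" if "x \<in> H\<^sub>u" for n x
  proof -
    have "cinner (v i k l) (W n x) = 0" if i: "i \<in> I" for i k l
      using linear_isometry_cinner[OF W, of n "v i k l" x] W_fix[OF Uv[OF i]] H\<^sub>uD[OF \<open>x \<in> H\<^sub>u\<close> i]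
      by simp
    then show ?thesis
      by (simp add: H\<^sub>u_def)
  qed
  define B :: "nat \<Rightarrow> ('i \<times> nat \<times> nat) set" where "B n = {(i, m, k). i \<in> I \<and> n \<le> m}" for n
  define f where "f = (\<lambda>(i, m, k). d i m k)"
  \<comment> \<open>Translation by \<open>1 / 2 ^ n\<close> moves an interval of level
    \<open>m \<ge> n\<close> by \<open>2 ^ (m - n)\<close> positions.\<close>
  define g where "g n = (\<lambda>(i, m, k). d i m (k + 2 ^ (m - n)))" for n
  \<comment> \<open>A shift by \<open>2 ^ (m + p - n)\<close> at the fine level is one by
    \<open>2 ^ (m - n)\<close> at the coarse level, so the nesting in \<open>d_gram\<close> is
    preserved.\<close>
  have gram_d: "cinner (d i m (k + 2 ^ (m - n))) (d j m' (k' + 2 ^ (m' - n))) = cinner (d i m k) (d j m' k')"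
    if ij: "i \<in> I" "j \<in> I" and le: "n \<le> m" "m \<le> m'" for i j m m' n k k'
  proof -
    obtain p where p: "m' = m + p"
      using le(2) le_Suc_ex by blast
    have "2 ^ (m + p - n) = 2 ^ (m - n) * (2::nat) ^ p"
      using le(1) by (simp flip: power_add)
    then have "(k' + 2 ^ (m + p - n)) div 2 ^ p = k' div 2 ^ p + 2 ^ (m - n)"
      by simp
    then show ?thesis
      unfolding p d_gram[OF ij] by simp
  qed
  have "\<exists>L. linear_isometry L \<and> (\<forall>x\<in>H\<^sub>u. L x = W n x) \<and> (\<forall>b\<in>B n. L (f b) = g n b)" for n
  proof (rule isometry_from_orthogonal_grams[of H\<^sub>u "W n" "\<lambda>x. x" "B n" "g n" f])
    show "cinner (W n x) (W n y) = cinner x y" for x y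
      by (rule linear_isometry_cinner[OF W])
    show "cinner (f b) x = 0" if "b \<in> B n" "x \<in> H\<^sub>u" for b x
      using that H\<^sub>u_d unfolding f_def B_def by auto
    show "cinner (g n b) (W n x) = 0" if "b \<in> B n" "x \<in> H\<^sub>u" for b x
      using that H\<^sub>u_d W_H\<^sub>u unfolding g_def B_def by auto
    show "cinner (g n b) (g n b') = cinner (f b) (f b')" if "b \<in> B n" "b' \<in> B n" for b b'
    proof -
      obtain i m k j m' k' where b: "b = (i, m, k)" "b' = (j, m', k')"
        by (cases b; cases b')
      have *: "i \<in> I" "j \<in> I" "n \<le> m" "n \<le> m'"
        using that b by (auto simp: B_def)
      show ?thesis
      proof (cases "m \<le> m'")
        case True
        with * show ?thesis
          by (simp add: b f_def g_def gram_d)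
      next
        case False
        then show ?thesis
          unfolding b f_def g_def prod.case
          using gram_d[OF *(2,1,4), of m k' k] cinner_commute[of "d i m _"] by simp
      qed
    qed
    show "total_set ((\<lambda>x. x) ` H\<^sub>u \<union> f ` B n)"
    proof -
      have "f ` B n = {d i m k | i m k. i \<in> I \<and> n \<le> m}"
        unfolding f_def B_def by force
      then show ?thesis
        using total_d by simp
    qed
    fix L assume "linear_isometry L" "\<And>x. x \<in> H\<^sub>u \<Longrightarrow> L x = W n x" "\<And>b. b \<in> B n \<Longrightarrow> L (f b) = g n b"
    then show ?thesis
      by blast
  qed
  then obtain L where L: "\<And>n. linear_isometry (L n)" and LW: "\<And>n x. x \<in> H\<^sub>u \<Longrightarrow> L n x = W n x"
    and Lfg: "\<And>n b. b \<in> B n \<Longrightarrow> L n (f b) = g n b"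
    by metis
  have Ld: "L n (d i m k) = d i m (k + 2 ^ (m - n))" if "i \<in> I" "n \<le> m" for n i m k
    using Lfg[of "(i, m, k)"] that by (simp add: B_def f_def g_def)
  \<comment> \<open>Translation by \<open>1 / 2 ^ (m + p)\<close> changes an interval of level
    \<open>m\<close> only at its ends: one fine interval is gained on the right and one lost on the
    left, each with weight \<open>(1 / sqrt 2) ^ p\<close>. The induction halves the interval and
    telescopes at the midpoint.\<close>
  have diff: "L (m + p) (d i m k) - d i m k
      = (1 / sqrt 2) ^ p *\<^sub>R (d i (m + p) (2 ^ p * (k + 1)) - d i (m + p) (2 ^ p * k))"
    if i: "i \<in> I" for i m p k
  proof (induction p arbitrary: m k)
    case 0
    show ?case
      using Ld[OF i, of m m k] by simp
  next
    case (Suc p)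
    let ?D = "\<lambda>k. d i (Suc m) k" and ?M = "Suc m + p"
    have eq: "2 ^ p * (2 * k) = 2 ^ Suc p * k" "2 ^ p * (2 * k + 1 + 1) = 2 ^ Suc p * (k + 1)"
      by (simp_all add: algebra_simps)
    have "L ?M (d i m k) - d i m k
        = (1 / sqrt 2) *\<^sub>R ((L ?M (?D (2 * k)) - ?D (2 * k)) + (L ?M (?D (2 * k + 1)) - ?D (2 * k + 1)))"
      unfolding d_split[of i m k] linear_scale[OF linear_isometry_linear[OF L]] linear_isometry_add[OF L]
      by (simp add: scaleR_add_right scaleR_diff_right)
    also have "\<dots> = (1 / sqrt 2) ^ Suc p *\<^sub>R (d i ?M (2 ^ Suc p * (k + 1)) - d i ?M (2 ^ Suc p * k))"
      unfolding Suc eq by (simp flip: scaleR_add_right)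
    finally show ?case
      by (simp only: add_Suc add_Suc_right)
  qed
  have norm_d: "norm (d i m k) = 1" if "i \<in> I" for i m k
  proof (rule power2_eq_imp_eq)
    show "(norm (d i m k))\<^sup>2 = 1\<^sup>2"
      using d_orth[OF that that, of m k k] by (simp add: cinner_self flip: of_real_power)
  qed auto
  have d_summable: "summable (\<lambda>n. norm (L n (d i m k) - d i m k))" if i: "i \<in> I" for i m k
  proof -
    have "norm (L (p + m) (d i m k) - d i m k) \<le> (1 / sqrt 2) ^ p * 2" for p
      unfolding add.commute[of p m]
      using norm_triangle_ineq4[of "d i (m + p) (2 ^ p * (k + 1))" "d i (m + p) (2 ^ p * k)"]
      by (simp add: diff[OF i] norm_d[OF i])
    moreover have "1 < sqrt 2"
      by simp
    then have "summable (\<lambda>p. (1 / sqrt 2) ^ p * 2)"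
      by (intro summable_mult2 summable_geometric) simp
    ultimately have "summable (\<lambda>p. norm (L (p + m) (d i m k) - d i m k))"
      using summable_comparison_test'[of "\<lambda>p. (1 / sqrt 2) ^ p * 2" 0
          "\<lambda>p. norm (L (p + m) (d i m k) - d i m k)"] by (simp only: real_norm_def abs_norm_cancel)
    then show ?thesis
      by (simp only: summable_iff_shift[of "\<lambda>n. norm (L n (d i m k) - d i m k)" m])
  qed
  have "root_tower L (H\<^sub>u \<union> {d i m k | i m k. i \<in> I \<and> 0 \<le> m})"
  proof
    show "linear_isometry (L n)" for n
      by (rule L)
    show "total_set (H\<^sub>u \<union> {d i m k | i m k. i \<in> I \<and> 0 \<le> m})"
      by (rule total_d)
    show "summable (\<lambda>n. norm (L n x - x))" if "x \<in> H\<^sub>u \<union> {d i m k | i m k. i \<in> I \<and> 0 \<le> m}" for x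
      using that d_summable W_summable[of x] by (auto simp: LW)
    \<comment> \<open>Outside \<open>H\<^sub>u\<close>, compared on levels at least
      \<open>Suc n\<close>, where both sides are shifts and
      \<open>2 * 2 ^ (m - Suc n) = 2 ^ (m - n)\<close>.\<close>
    have "L (Suc n) \<circ> L (Suc n) = L n" for n
    proof (rule total_imp_eq[OF linear_isometry_compose[OF L L] L _ total_d])
      fix x assume "x \<in> H\<^sub>u \<union> {d i m k | i m k. i \<in> I \<and> Suc n \<le> m}"
      then consider "x \<in> H\<^sub>u" | i m k where "x = d i m k" "i \<in> I" "Suc n \<le> m"
        by blast
      then show "(L (Suc n) \<circ> L (Suc n)) x = L n x"
      proof cases
        case 1
        then show ?thesis
          by (simp add: LW W_H\<^sub>u WW)
      next
        case 2
        have "m - n = Suc (m - Suc n)"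
          using 2 by simp
        then show ?thesis
          using 2 by (simp add: Ld add.assoc flip: mult_2)
      qed
    qed
    then show "L (Suc n) (L (Suc n) x) = L n x" for n x
      by (metis comp_apply)
  qed
  then have "embeddable (L 0)"
    by (rule root_tower.embeddable)
  \<comment> \<open>At \<open>n = 0\<close> the shift at level \<open>m\<close> is by
    \<open>2 ^ m\<close>, which by \<open>V_d\<close> is the action of \<open>V\<close>.\<close>
  moreover have "L 0 = V"
  proof (rule total_imp_eq[OF L V _ total_d])
    fix x assume "x \<in> H\<^sub>u \<union> {d i m k | i m k. i \<in> I \<and> 0 \<le> m}"
    then show "L 0 x = V x"
      by (auto simp: LW W0 UV Ld V_d)
  qed
  ultimately show ?thesis
    by simp
qed

end

section \<open>The two sufficient conditions and the equivalence\<close>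

lemma embeddable_if_surj:
  fixes V :: "'a::chilbert_space \<Rightarrow> 'a"
  assumes "linear_isometry V" "surj V"
  shows "embeddable V"
proof -
  obtain W where W: "W 0 = V" "\<And>n. linear_isometry (W n)"
    "\<And>n x. W (Suc n) (W (Suc n) x) = W n x" "\<And>x. summable (\<lambda>n. norm (W n x - x))"
    by (rule unitary_root_tower[OF assms]) (rule that)
  have "root_tower W UNIV"
  proof
    show "total_set (UNIV :: 'a set)"
      unfolding total_set_def using cinner_self_eq_0 by blast
  qed (simp_all add: W)
  from root_tower.embeddable[OF this] show ?thesis
    by (simp add: W(1))
qed

lemma embeddable_if_codim_infinite:
  fixes V :: "'a::chilbert_space \<Rightarrow> 'a"
  assumes V: "linear_isometry V" and codim: "codim (range V) = \<infinity>"
  shows "embeddable V"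
proof -
  obtain E where E: "corthonormal E" "\<And>e x. e \<in> E \<Longrightarrow> cinner e (V x) = 0"
    "\<And>x. (\<And>e. e \<in> E \<Longrightarrow> cinner e x = 0) \<Longrightarrow> x \<in> range V"
    using wandering_basis_exists[OF V] by blast
  have "infinite E"
    using finite_quotient_basis_if_wandering_basis[OF V E(1) _ E(2,3)] codim
    unfolding codim_eq_infinity_iff by blast
  \<comment> \<open>Each \<open>i\<close> receives a sequence \<open>b (i, n)\<close>, the Haar
    basis of a unit interval, from which the powers of \<open>V\<close> generate a copy of L2 of the
    half line.\<close>
  then obtain b :: "'a \<times> nat \<Rightarrow> 'a" where b: "bij_betw b (E \<times> UNIV) E"
    using bij_betw_Times_nat_exists by blast
  have bE: "b (i, n) \<in> E" if "i \<in> E" for i n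
    using bij_betwE[OF b] that by blast
  have "haar V E (\<lambda>i n. b (i, n))"
  proof
    show "linear_isometry V"
      by fact
    show "cinner (b (i, m)) (b (j, n)) = (if i = j \<and> m = n then 1 else 0)"
      if "i \<in> E" "j \<in> E" for i j m n
      using E(1) bE that inj_on_eq_iff[OF bij_betw_imp_inj_on[OF b], of "(i, m)" "(j, n)"]
      unfolding corthonormal_def by auto
    show "cinner (b (i, n)) (V x) = 0" if "i \<in> E" for i n x
      using E(2) bE that by blast
    show "x \<in> range V" if x: "\<And>i n. i \<in> E \<Longrightarrow> cinner (b (i, n)) x = 0" for x
    proof (rule E(3))
      fix e assume "e \<in> E"
      then obtain i n where "i \<in> E" "e = b (i, n)"
        using bij_betw_imp_surj_on[OF b] by blast
      with x show "cinner e x = 0"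
        by simp
    qed
  qed
  then show ?thesis
    by (rule haar.embeddable)
qed

theorem theorem4p4:
  fixes V :: "'a::chilbert_space \<Rightarrow> 'a"
  assumes "linear_isometry V"
  shows "embeddable V \<longleftrightarrow> unitary V \<or> codim (range V) = \<infinity>"
  using codim_range_if_embeddable[OF assms] embeddable_if_codim_infinite[OF assms]
    embeddable_if_surj[OF assms] unitary_iff_surj[OF assms] by metis

end
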